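(* Let $n\ge1$ be an integer and let $\lambda$ be a real constant. Suppose $\rho_0\equiv\rho_c$ with a constant $\rho_c>0$, and $v_0\equiv0$. Then the solution of the radial Euler-Poisson system with initial data $(\rho_0,v_0)$ is global if and only if $\lambda<0$. If $\lambda<0$ then the corresponding solution satisfies $$\rho\in C^2([0,\infty),D^\infty)\cap C^\infty((0,\infty),D^\infty),\quad v\in C^1([0,\infty),D^\infty)\cap C^\infty((0,\infty),D^\infty),$$ $$\Phi\in C^2([0,\infty),D^\infty)\cap C^\infty((0,\infty),D^\infty).$$ Furthermore, it is unique in $C^2([0,\infty),D^0)\times C^1([0,\infty),D^1)\times C^2([0,\infty),D^2)$ (under a condition on $\Phi$ such as $\Phi(0,0)=0$), and it also solves the multi-dimensional Euler-Poisson equations in the distribution sense.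
   Context: Function spaces: $D^0:=C([0,\infty))$, $D^s:=C([0,\infty))\cap C^s((0,\infty))$ for integers $s>0$, and $D^\infty:=C([0,\infty))\cap C^\infty((0,\infty))$. Radial Euler-Poisson system for $\rho(t,r),v(t,r),\Phi(t,r)$, $(t,r)\in\mathbb{R}_+\times\mathbb{R}_+$: $$r^{n-1}\rho_t+\partial_r(r^{n-1}\rho v)=0,\quad v_t+v\,\partial_rv+\lambda\,\partial_r\Phi=0,\quad\partial_r(r^{n-1}\partial_r\Phi)=r^{n-1}\rho,\quad(\rho,v)(0,r)=(\rho_0,v_0)(r).$$ The solution is global if a classical solution exists for all $t\ge0$; otherwise it breaks down in finite time. In the uniqueness class, where $\rho$ need not be differentiable in $r$, the first equation is understood as $\partial_tm+v\,\partial_rm=0$ with $m(t,r)=\int_0^r\rho(t,s)s^{n-1}ds$. If $(\rho,v,\Phi)$ is a solution, then so is $(\rho,v,\Phi+c)$ for any constant $c$; therefore uniqueness is understood under a certain condition on $\Phi$, such as $\Phi(0,0)=0$. Multi-dimensional Euler-Poisson equations: for $x\in\mathbb{R}^n$ put $\mathbf r(t,x)=\rho(t,|x|)$, $\mathbf v(t,x)=\frac x{|x|}v(t,|x|)$, $\mathbf P(t,x)=\Phi(t,|x|)$; the equations are $\mathbf r_t+\mathrm{div}(\mathbf r\mathbf v)=0$, $\mathbf v_t+\mathbf v\cdot\nabla\mathbf v=-\lambda\nabla\mathbf P$, $\Delta\mathbf P=\mathbf r$.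
   Formalization: λ≠0 is assumed, since at λ=0 the static ρ=ρ_c, v=0, Φ=ρ_c r²/(2n) is a global solution and the equivalence fails; uniqueness of Φ is under Φ(t,0)=0 for all t≥0, because Φ(0,0)=0 alone still allows adding c(t) with c(0)=0. *)

theory Defs
  imports "HOL-Analysis.Analysis" "HOL-Library.Extended_Nat"
begin

section \<open>The spaces \<open>D\<^sup>s\<close> and curves in them\<close>

text \<open>Elements of \<open>D\<^sup>s = C([0,\<infinity>)) \<inter> C\<^sup>s((0,\<infinity>))\<close> are represented by functions on the whole real
  line whose values at negative arguments are irrelevant; \<open>s = \<infinity>\<close> is allowed.\<close>

definition D_space :: "enat \<Rightarrow> (real \<Rightarrow> real) set" where
  "D_space s = {g. continuous_on {0..} g \<and>
     (\<forall>i. enat i \<le> s \<longrightarrow> continuous_on {0<..} ((deriv ^^ i) g)) \<and>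
     (\<forall>i. enat i < s \<longrightarrow> (\<forall>r>0. (deriv ^^ i) g differentiable (at r)))}"

text \<open>Convergence in the usual Frechet topology of \<open>D\<^sup>s\<close>: locally uniformly on \<open>[0,\<infinity>)\<close>, together
  with locally uniform convergence on \<open>(0,\<infinity>)\<close> of all derivatives of order at most \<open>s\<close>.\<close>

definition D_tendsto ::
  "enat \<Rightarrow> ('a \<Rightarrow> real \<Rightarrow> real) \<Rightarrow> (real \<Rightarrow> real) \<Rightarrow> 'a filter \<Rightarrow> bool" where
  "D_tendsto s g l F \<longleftrightarrow>
     (\<forall>R. uniform_limit {0..R} g l F) \<and>
     (\<forall>i a b. enat i \<le> s \<and> 0 < a \<longrightarrow>
        uniform_limit {a..b} (\<lambda>x. (deriv ^^ i) (g x)) ((deriv ^^ i) l) F)"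

text \<open>\<open>C_curve k s I F\<close>: the map \<open>t \<mapsto> F(t,\<cdot>)\<close> is a \<open>C\<^sup>k\<close> map from the interval \<open>I\<close> into
  \<open>D\<^sup>s\<close>, time derivatives being limits of difference quotients in the topology of \<open>D\<^sup>s\<close>
  (one-sided at endpoints belonging to \<open>I\<close>).\<close>

primrec C_curve :: "nat \<Rightarrow> enat \<Rightarrow> real set \<Rightarrow> (real \<Rightarrow> real \<Rightarrow> real) \<Rightarrow> bool" where
  "C_curve 0 s I F \<longleftrightarrow>
     (\<forall>t\<in>I. F t \<in> D_space s \<and> D_tendsto s F (F t) (at t within I))"
| "C_curve (Suc k) s I F \<longleftrightarrow>
     (\<forall>t\<in>I. F t \<in> D_space s) \<and>
     (\<exists>F'. (\<forall>t\<in>I. D_tendsto s (\<lambda>\<tau> r. (F \<tau> r - F t r) / (\<tau> - t)) (F' t) (at t within I)) \<and>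
           C_curve k s I F')"

definition C_curves :: "enat \<Rightarrow> real set \<Rightarrow> enat \<Rightarrow> (real \<Rightarrow> real \<Rightarrow> real) set" where
  "C_curves k I s = {F. \<forall>j. enat j \<le> k \<longrightarrow> C_curve j s I F}"

section \<open>The radial Euler-Poisson system\<close>

text \<open>All equations are required for \<open>t \<ge> 0\<close> and \<open>r > 0\<close>; the time derivative at \<open>t = 0\<close> is
  one-sided.\<close>

definition radial_continuity :: "nat \<Rightarrow> (real \<Rightarrow> real \<Rightarrow> real) \<Rightarrow> (real \<Rightarrow> real \<Rightarrow> real) \<Rightarrow> bool" where
  "radial_continuity n \<rho> v \<longleftrightarrow> (\<forall>t\<ge>0. \<forall>r>0. \<exists>\<rho>t fr.
     ((\<lambda>\<tau>. \<rho> \<tau> r) has_real_derivative \<rho>t) (at t within {0..}) \<and>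
     ((\<lambda>s. s ^ (n - 1) * \<rho> t s * v t s) has_real_derivative fr) (at r) \<and>
     r ^ (n - 1) * \<rho>t + fr = 0)"

definition mass :: "nat \<Rightarrow> (real \<Rightarrow> real \<Rightarrow> real) \<Rightarrow> real \<Rightarrow> real \<Rightarrow> real" where
  "mass n \<rho> t r = integral {0..r} (\<lambda>s. \<rho> t s * s ^ (n - 1))"

definition radial_mass_transport :: "nat \<Rightarrow> (real \<Rightarrow> real \<Rightarrow> real) \<Rightarrow> (real \<Rightarrow> real \<Rightarrow> real) \<Rightarrow> bool" where
  "radial_mass_transport n \<rho> v \<longleftrightarrow> (\<forall>t\<ge>0. \<forall>r>0. \<exists>mt mr.
     ((\<lambda>\<tau>. mass n \<rho> \<tau> r) has_real_derivative mt) (at t within {0..}) \<and>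
     (mass n \<rho> t has_real_derivative mr) (at r) \<and>
     mt + v t r * mr = 0)"

definition radial_momentum :: "real \<Rightarrow> (real \<Rightarrow> real \<Rightarrow> real) \<Rightarrow> (real \<Rightarrow> real \<Rightarrow> real) \<Rightarrow> bool" where
  "radial_momentum lam v \<Phi> \<longleftrightarrow> (\<forall>t\<ge>0. \<forall>r>0. \<exists>vt vr \<Phi>r.
     ((\<lambda>\<tau>. v \<tau> r) has_real_derivative vt) (at t within {0..}) \<and>
     (v t has_real_derivative vr) (at r) \<and>
     (\<Phi> t has_real_derivative \<Phi>r) (at r) \<and>
     vt + v t r * vr + lam * \<Phi>r = 0)"

definition radial_poisson :: "nat \<Rightarrow> (real \<Rightarrow> real \<Rightarrow> real) \<Rightarrow> (real \<Rightarrow> real \<Rightarrow> real) \<Rightarrow> bool" where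
  "radial_poisson n \<rho> \<Phi> \<longleftrightarrow> (\<forall>t\<ge>0. \<exists>\<Phi>r. \<forall>r>0.
     (\<Phi> t has_real_derivative \<Phi>r r) (at r) \<and>
     ((\<lambda>s. s ^ (n - 1) * \<Phi>r s) has_real_derivative r ^ (n - 1) * \<rho> t r) (at r))"

text \<open>The system with the continuity equation in its integrated form
  \<open>m\<^sub>t + v m\<^sub>r = 0\<close>, which does not require \<open>\<rho>\<close> to be differentiable in \<open>r\<close>.\<close>

definition radial_EP :: "nat \<Rightarrow> real \<Rightarrow> (real \<Rightarrow> real) \<Rightarrow> (real \<Rightarrow> real) \<Rightarrow>
    (real \<Rightarrow> real \<Rightarrow> real) \<Rightarrow> (real \<Rightarrow> real \<Rightarrow> real) \<Rightarrow> (real \<Rightarrow> real \<Rightarrow> real) \<Rightarrow> bool" where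
  "radial_EP n lam \<rho>0 v0 \<rho> v \<Phi> \<longleftrightarrow>
     radial_mass_transport n \<rho> v \<and> radial_momentum lam v \<Phi> \<and> radial_poisson n \<rho> \<Phi> \<and>
     (\<forall>r\<ge>0. \<rho> 0 r = \<rho>0 r \<and> v 0 r = v0 r)"

text \<open>The system is globally solvable if it has a classical solution for all \<open>t \<ge> 0\<close>: the
  derivatives occurring in the (integrated) system exist and are continuous. The regularity
  required here is the least one making sense of the equations, hence weaker than
  \<open>C\<^sup>2([0,\<infinity>),D\<^sup>0) \<times> C\<^sup>1([0,\<infinity>),D\<^sup>1) \<times> C\<^sup>2([0,\<infinity>),D\<^sup>2)\<close>; so non-globality excludes
  solutions of that class as well.\<close>

definition has_global_solution :: "nat \<Rightarrow> real \<Rightarrow> (real \<Rightarrow> real) \<Rightarrow> (real \<Rightarrow> real) \<Rightarrow> bool" where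
  "has_global_solution n lam \<rho>0 v0 \<longleftrightarrow> (\<exists>\<rho> v \<Phi>.
     \<rho> \<in> C_curves 1 {0..} 0 \<and> v \<in> C_curves 1 {0..} 1 \<and> \<Phi> \<in> C_curves 0 {0..} 2 \<and>
     radial_EP n lam \<rho>0 v0 \<rho> v \<Phi>)"

section \<open>Distributions on \<open>(0,\<infinity>) \<times> \<real>\<^sup>n\<close>\<close>

primrec Ck_on_UNIV :: "nat \<Rightarrow> ('a::euclidean_space \<Rightarrow> real) \<Rightarrow> bool" where
  "Ck_on_UNIV 0 f \<longleftrightarrow> continuous_on UNIV f"
| "Ck_on_UNIV (Suc k) f \<longleftrightarrow> (\<forall>x. f differentiable (at x)) \<and>
     (\<forall>b\<in>Basis. Ck_on_UNIV k (\<lambda>x. frechet_derivative f (at x) b))"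

definition spacetime :: "(real \<times> (real ^ 'n)) set" where
  "spacetime = {0<..} \<times> UNIV"

text \<open>Elements of \<open>C\<^sub>c\<^sup>\<infinity>((0,\<infinity>) \<times> \<real>\<^sup>n)\<close>, extended by zero.\<close>

definition test_function :: "(real \<times> (real ^ 'n) \<Rightarrow> real) \<Rightarrow> bool" where
  "test_function \<phi> \<longleftrightarrow> (\<forall>k. Ck_on_UNIV k \<phi>) \<and>
     (\<exists>K. compact K \<and> K \<subseteq> spacetime \<and> (\<forall>z. z \<notin> K \<longrightarrow> \<phi> z = 0))"

definition loc_integrable :: "(real \<times> (real ^ 'n) \<Rightarrow> real) \<Rightarrow> bool" where
  "loc_integrable f \<longleftrightarrow> (\<forall>K. compact K \<and> K \<subseteq> spacetime \<longrightarrow> set_integrable lborel K f)"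

text \<open>A locally integrable function regarded as a distribution. Test functions vanish for
  \<open>t \<le> 0\<close>, so the integral only sees \<open>f\<close> on \<open>spacetime\<close>.\<close>

definition distr :: "(real \<times> (real ^ 'n) \<Rightarrow> real) \<Rightarrow> (real \<times> (real ^ 'n) \<Rightarrow> real) \<Rightarrow> real" where
  "distr f \<phi> = (LINT z|lborel. f z * \<phi> z)"

definition distr_deriv :: "real \<times> (real ^ 'n) \<Rightarrow> ((real \<times> (real ^ 'n) \<Rightarrow> real) \<Rightarrow> real) \<Rightarrow>
    (real \<times> (real ^ 'n) \<Rightarrow> real) \<Rightarrow> real" where
  "distr_deriv e T \<phi> = - T (\<lambda>z. frechet_derivative \<phi> (at z) e)"

abbreviation D_t :: "((real \<times> (real ^ 'n) \<Rightarrow> real) \<Rightarrow> real) \<Rightarrow> (real \<times> (real ^ 'n) \<Rightarrow> real) \<Rightarrow> real" where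
  "D_t \<equiv> distr_deriv (1, 0)"

abbreviation D_x :: "'n \<Rightarrow> ((real \<times> (real ^ 'n) \<Rightarrow> real) \<Rightarrow> real) \<Rightarrow>
    (real \<times> (real ^ 'n) \<Rightarrow> real) \<Rightarrow> real" where
  "D_x i \<equiv> distr_deriv (0, axis i 1)"

section \<open>The multi-dimensional Euler-Poisson equations\<close>

text \<open>In the momentum equation \<open>\<nabla>\<^bold>v\<close> is the distributional gradient, which is required to be a
  locally integrable function \<open>G\<close> (\<open>G i j\<close> being \<open>\<partial>\<^sub>j v\<^sub>i\<close>), so that the product
  \<open>\<^bold>v \<cdot> \<nabla>\<^bold>v\<close> makes sense.\<close>

definition EP_distributional :: "real \<Rightarrow> (real \<times> (real ^ 'n) \<Rightarrow> real) \<Rightarrow>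
    (real \<times> (real ^ 'n) \<Rightarrow> real ^ 'n) \<Rightarrow> (real \<times> (real ^ 'n) \<Rightarrow> real) \<Rightarrow> bool" where
  "EP_distributional lam \<rho> v P \<longleftrightarrow>
     loc_integrable \<rho> \<and> loc_integrable P \<and>
     (\<forall>i. loc_integrable (\<lambda>z. v z $ i) \<and> loc_integrable (\<lambda>z. \<rho> z * v z $ i)) \<and>
     (\<forall>\<phi>. test_function \<phi> \<longrightarrow>
        D_t (distr \<rho>) \<phi> + (\<Sum>i\<in>UNIV. D_x i (distr (\<lambda>z. \<rho> z * v z $ i)) \<phi>) = 0) \<and>
     (\<exists>G. (\<forall>i j. loc_integrable (G i j) \<and> loc_integrable (\<lambda>z. v z $ j * G i j z) \<and>
              (\<forall>\<phi>. test_function \<phi> \<longrightarrow> D_x j (distr (\<lambda>z. v z $ i)) \<phi> = distr (G i j) \<phi>)) \<and>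
          (\<forall>i \<phi>. test_function \<phi> \<longrightarrow>
              D_t (distr (\<lambda>z. v z $ i)) \<phi> + distr (\<lambda>z. \<Sum>j\<in>UNIV. v z $ j * G i j z) \<phi>
              = - lam * D_x i (distr P) \<phi>)) \<and>
     (\<forall>\<phi>. test_function \<phi> \<longrightarrow>
        (\<Sum>i\<in>UNIV. D_x i (D_x i (distr P)) \<phi>) = distr \<rho> \<phi>)"

definition radial_scalar :: "(real \<Rightarrow> real \<Rightarrow> real) \<Rightarrow> real \<times> (real ^ 'n) \<Rightarrow> real" where
  "radial_scalar f z = f (fst z) (norm (snd z))"

text \<open>At \<open>x = 0\<close> the value is \<open>0\<close> because division by zero yields zero.\<close>

definition radial_vector :: "(real \<Rightarrow> real \<Rightarrow> real) \<Rightarrow> real \<times> (real ^ 'n) \<Rightarrow> real ^ 'n" where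
  "radial_vector v z = (v (fst z) (norm (snd z)) / norm (snd z)) *\<^sub>R snd z"

end

theory Submission
  imports Defs
begin

text \<open>
  A uniform ball stays uniform: the solution is \<open>\<rho> = \<rho>c / s\<^sup>n\<close>, \<open>v = r s' / s\<close>,
  \<open>\<Phi> = \<rho>c r\<^sup>2 / (2 n s\<^sup>n)\<close>, where \<open>s'' = - (\<lambda> \<rho>c / n) s\<^bsup>1 - n\<^esup>\<close>, \<open>s(0) = 1\<close>, \<open>s'(0) = 0\<close>. For
  \<open>\<lambda> < 0\<close> the scale factor \<open>s\<close> increases and exists for all times, while for \<open>\<lambda> > 0\<close> it reaches \<open>0\<close> in
  finite time, where the density blows up. Any other solution of the system must agree with this one as long as
  \<open>s\<close> exists: where the central density is positive, the mass equation gives \<open>v = O(r)\<close>, which excludes a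
  point charge at the centre, and then the velocity and the mass are determined along the curves
  \<open>r = R s(t)\<close> by a linear system of differential equations. Positivity of the central density
  propagates in time because the formula for \<open>\<rho>\<close> persists up to a first zero.
\<close>

section \<open>The equation of the scale factor\<close>

text \<open>With \<open>v = r s' / s\<close> one has \<open>v_t + v v_r = r s'' / s\<close>, while a
  uniform density gives \<open>\<Phi>_r = \<rho> r / n\<close>; cancelling r leaves the equation of
  s. The real difficulty is the centre. The Poisson equation is imposed only for r > 0, so it fixes
  \<open>r^(n-1) \<Phi>_r\<close> up to a constant c(t), a point charge at the origin, and a nonzero
  c would change the motion. For n = 1 the force of such a charge is not even singular, so c has to
  be excluded through the behaviour of v at r = 0. The handle on v there is the flux
  \<open>\<rho> v\<close>, which says nothing where the density vanishes; this is why positivity of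
  the central density has to accompany the whole comparison. The comparison uses v and the
  integrated mass instead of \<rho>, because \<rho> need not be differentiable in r, whereas the
  r-derivative of the mass is \<open>\<rho> r^(n-1)\<close>. Collapse needs no energy integral: as
  long as s \<le> 1 the attractive acceleration is at least b = lam \<rho>c / n in size, which alone
  bounds the collapse time by sqrt (2 / b).\<close>

primrec picard :: "('a::banach \<Rightarrow> 'a) \<Rightarrow> 'a \<Rightarrow> nat \<Rightarrow> real \<Rightarrow> 'a" where
  "picard F y0 0 t = y0"
| "picard F y0 (Suc k) t = y0 + integral {0..t} (\<lambda>u. F (picard F y0 k u))"

lemma norm_integral_diff_le:
  fixes f g :: "real \<Rightarrow> 'a::banach"
  assumes "continuous_on {0..t} f" "continuous_on {0..t} g" "continuous_on {0..t} h"
    and "\<And>u. u \<in> {0..t} \<Longrightarrow> norm (f u - g u) \<le> h u"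
  shows "norm (integral {0..t} f - integral {0..t} g) \<le> integral {0..t} h"
proof -
  have "integral {0..t} f - integral {0..t} g = integral {0..t} (\<lambda>u. f u - g u)"
    using assms by (simp add: Henstock_Kurzweil_Integration.integral_diff integrable_continuous_real)
  also have "norm \<dots> \<le> integral {0..t} h"
    using assms by (intro integral_norm_bound_integral integrable_continuous_real)
      (auto intro!: continuous_intros)
  finally show ?thesis .
qed

lemma picard_continuous:
  assumes "continuous_on UNIV F"
  shows "continuous_on {0..T} (picard F y0 k)"
proof (induction k)
  case (Suc k)
  have "continuous_on {0..T} (\<lambda>u. F (picard F y0 k u))"
    by (rule continuous_on_compose2[OF assms Suc]) auto
  then show ?case
    by (auto intro!: continuous_intros indefinite_integral_continuous_1 integrable_continuous_real)
qed simp

text \<open>Integrating the previous bound turns \<open>u ^ k / fact k\<close> into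
  \<open>t ^ Suc k / fact (Suc k)\<close> and gains one factor L. The resulting exponential series
  converges for every T, so the iteration is not restricted to short times.\<close>

lemma picard_step_bound:
  assumes F: "L-lipschitz_on UNIV F" and "t \<in> {0..T}"
  shows "norm (picard F y0 (Suc k) t - picard F y0 k t) \<le> T * norm (F y0) * ((L * t) ^ k / fact k)"
  using \<open>t \<in> {0..T}\<close>
proof (induction k arbitrary: t)
  case 0
  then show ?case by (simp add: mult_right_mono)
next
  case (Suc k)
  have cont: "continuous_on {0..t} (\<lambda>u. F (picard F y0 j u))" for j
    by (rule continuous_on_compose2[OF lipschitz_on_continuous_on[OF F] picard_continuous])
      (use F lipschitz_on_continuous_on in auto)
  have L: "0 \<le> L" using F by (rule lipschitz_on_nonneg)
  let ?B = "T * norm (F y0)"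
  have "picard F y0 (Suc (Suc k)) t - picard F y0 (Suc k) t =
     integral {0..t} (\<lambda>u. F (picard F y0 (Suc k) u)) - integral {0..t} (\<lambda>u. F (picard F y0 k u))"
    by simp
  also have "norm \<dots> \<le> integral {0..t} (\<lambda>u. L * (?B * ((L * u) ^ k / fact k)))"
  proof (intro norm_integral_diff_le cont)
    fix u assume u: "u \<in> {0..t}"
    have "norm (F (picard F y0 (Suc k) u) - F (picard F y0 k u))
        \<le> L * norm (picard F y0 (Suc k) u - picard F y0 k u)"
      using lipschitz_onD[OF F, of "picard F y0 (Suc k) u" "picard F y0 k u"] by (simp add: dist_norm)
    also have "\<dots> \<le> L * (?B * ((L * u) ^ k / fact k))"
      using u Suc.prems L by (intro mult_left_mono Suc.IH) auto
    finally show "norm (F (picard F y0 (Suc k) u) - F (picard F y0 k u)) \<le> \<dots>" .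
  qed (auto intro!: continuous_intros)
  also have "(\<lambda>u. L * (?B * ((L * u) ^ k / fact k))) = (\<lambda>u. (L ^ Suc k * ?B / fact k) * u ^ k)"
    by (auto simp: power_mult_distrib fun_eq_iff)
  also have "integral {0..t} (\<lambda>u. (L ^ Suc k * ?B / fact k) * u ^ k)
      = (L ^ Suc k * ?B / fact k) * (t ^ Suc k / Suc k)"
  proof -
    have "((\<lambda>u. u ^ k) has_integral (t ^ Suc k / Suc k - 0 ^ Suc k / Suc k)) {0..t}"
      using Suc.prems
      by (intro fundamental_theorem_of_calculus)
        (auto intro!: derivative_eq_intros simp flip: has_real_derivative_iff_has_vector_derivative
         simp del: power_Suc of_nat_Suc)
    then show ?thesis by (simp add: integral_unique)
  qed
  also have "\<dots> = ?B * ((L * t) ^ Suc k / fact (Suc k))"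
    by (simp add: power_mult_distrib field_simps)
  finally show ?case .
qed

lemma picard_uniform_limit:
  assumes F: "L-lipschitz_on UNIV F" and "0 \<le> T"
  shows "uniform_limit {0..T} (picard F y0) (\<lambda>t. lim (\<lambda>k. picard F y0 k t)) sequentially"
proof -
  have L: "0 \<le> L" using F by (rule lipschitz_on_nonneg)
  let ?d = "\<lambda>k t. picard F y0 (Suc k) t - picard F y0 k t"
  have "uniform_limit {0..T} (\<lambda>n t. \<Sum>i<n. ?d i t) (\<lambda>t. suminf (\<lambda>i. ?d i t)) sequentially"
  proof (rule Weierstrass_m_test)
    fix k t assume t: "t \<in> {0..T}"
    have "norm (?d k t) \<le> T * norm (F y0) * ((L * t) ^ k / fact k)"
      by (rule picard_step_bound[OF F t])
    also have "\<dots> \<le> T * norm (F y0) * ((L * T) ^ k / fact k)"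
      using t L by (intro mult_left_mono divide_right_mono power_mono) auto
    finally show "norm (?d k t) \<le> \<dots>" .
  next
    show "summable (\<lambda>k. T * norm (F y0) * ((L * T) ^ k / fact k))"
      using summable_exp_generic[of "L * T"] by (intro summable_mult) (simp add: field_simps)
  qed
  then have "uniform_limit {0..T} (\<lambda>k t. y0 + (picard F y0 k t - y0))
      (\<lambda>t. y0 + suminf (\<lambda>i. ?d i t)) sequentially"
    using sum_lessThan_telescope[of "\<lambda>i. picard F y0 i t" for t]
    by (intro uniform_limit_intros) (simp del: picard.simps(2))
  then have *: "uniform_limit {0..T} (picard F y0) (\<lambda>t. y0 + suminf (\<lambda>i. ?d i t)) sequentially"
    by (simp add: algebra_simps)
  have "lim (\<lambda>k. picard F y0 k t) = y0 + suminf (\<lambda>i. ?d i t)" if "t \<in> {0..T}" for t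
    using tendsto_uniform_limitI[OF * that] by (rule limI)
  then show ?thesis by (intro uniform_limit_cong'[THEN iffD1, OF _ _ *]) auto
qed

text \<open>The limits on the various intervals \<open>{0..T}\<close> are one and the same pointwise
  limit, so a single y is obtained on all of [0,\<infinity>). The integral equation passes to the
  limit because F is uniformly continuous.\<close>

theorem picard_lindeloef:
  fixes F :: "'a::banach \<Rightarrow> 'a"
  assumes F: "L-lipschitz_on UNIV F"
  obtains y where "y 0 = y0" "\<And>t. 0 \<le> t \<Longrightarrow> (y has_vector_derivative F (y t)) (at t within {0..})"
proof -
  define y where "y = (\<lambda>t. lim (\<lambda>k. picard F y0 k t))"
  have unif: "uniform_limit {0..T} (picard F y0) y sequentially" if "0 \<le> T" for T
    unfolding y_def by (rule picard_uniform_limit[OF F that])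
  have contF: "continuous_on UNIV F" using F by (rule lipschitz_on_continuous_on)
  have conty: "continuous_on {0..T} y" if "0 \<le> T" for T
    by (rule uniform_limit_theorem[OF _ unif[OF that]]) (use picard_continuous[OF contF] in auto)
  have cont: "continuous_on {0..T} (\<lambda>u. F (y u))" if "0 \<le> T" for T
    by (rule continuous_on_compose2[OF contF conty[OF that]]) auto
  have eq: "y t = y0 + integral {0..t} (\<lambda>u. F (y u))" if t: "0 \<le> t" for t
  proof -
    have "uniform_limit {0..t} (\<lambda>k u. F (picard F y0 k u)) (\<lambda>u. F (y u)) sequentially"
      by (rule uniform_limit_compose_uniformly_continuous_on[OF unif[OF t]
          lipschitz_on_uniformly_continuous[OF F]]) auto
    then obtain I J where IJ: "\<And>k. ((\<lambda>u. F (picard F y0 k u)) has_integral I k) {0..t}"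
      "((\<lambda>u. F (y u)) has_integral J) {0..t}" "I \<longlonglongrightarrow> J"
      by (rule uniform_limit_integral)
        (auto intro!: continuous_on_compose2[OF contF picard_continuous[OF contF]])
    have I: "I = (\<lambda>k. integral {0..t} (\<lambda>u. F (picard F y0 k u)))"
      by (rule ext) (rule integral_unique[OF IJ(1), symmetric])
    have "(\<lambda>k. picard F y0 (Suc k) t) \<longlonglongrightarrow> y0 + J"
      unfolding picard.simps by (intro tendsto_intros) (use IJ(3) in \<open>simp add: I\<close>)
    moreover have "(\<lambda>k. picard F y0 (Suc k) t) \<longlonglongrightarrow> y t"
      using tendsto_uniform_limitI[OF unif[OF t], of t] t by (intro LIMSEQ_Suc) auto
    ultimately show ?thesis using IJ(2) by (metis LIMSEQ_unique integral_unique)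
  qed
  show thesis
  proof (rule that[of y])
    show "y 0 = y0" using eq[of 0] by simp
    fix t :: real assume t: "0 \<le> t"
    have "((\<lambda>t. y0 + integral {0..t} (\<lambda>u. F (y u))) has_vector_derivative 0 + F (y t)) (at t within {0..t+1})"
      using t by (intro derivative_intros integral_has_vector_derivative cont) auto
    then have "((\<lambda>t. y0 + integral {0..t} (\<lambda>u. F (y u))) has_vector_derivative F (y t)) (at t within {0..t+1})"
      by simp
    then have "(y has_vector_derivative F (y t)) (at t within {0..t+1})"
      by (rule has_vector_derivative_transform[rotated 2]) (use t eq in auto)
    moreover have "at t within {0..t+1} = at t within {0..}"
      using t by (intro at_within_nhd[where S="{..<t+1}"]) auto
    ultimately show "(y has_vector_derivative F (y t)) (at t within {0..})" by simp
  qed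
qed

section \<open>Truncated power force, expanding and collapsing scale factors\<close>

text \<open>On [d,\<infinity>) the derivative of z^(-m) is at most m d^(-m-1) in size, and
  \<open>max x d\<close> is 1-Lipschitz in x.\<close>

lemma lipschitz_inverse_max_power:
  fixes d :: real
  assumes d: "0 < d"
  shows "(m / d ^ Suc m)-lipschitz_on UNIV (\<lambda>x. inverse (max x d) ^ m)"
proof (rule lipschitz_onI)
  fix x y :: real
  have "norm (inverse (max x d) ^ m - inverse (max y d) ^ m) \<le> (m / d ^ Suc m) * norm (max x d - max y d)"
  proof (rule field_differentiable_bound[of "{d..}"])
    fix z assume z: "z \<in> {d..}"
    then show "((\<lambda>z. inverse z ^ m) has_field_derivative - (m * inverse z ^ Suc m)) (at z within {d..})"
      using d DERIV_power_Suc[OF DERIV_inverse, of z "m - 1" "{d..}"]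
      by (cases m) (auto simp: algebra_simps)
    have "real m * inverse z ^ Suc m \<le> m * inverse d ^ Suc m"
      using z d by (intro mult_left_mono power_mono le_imp_inverse_le) auto
    then show "norm (- (m * inverse z ^ Suc m)) \<le> m / d ^ Suc m"
      using z d by (simp add: abs_mult field_simps)
  qed auto
  also have "\<dots> \<le> (m / d ^ Suc m) * norm (x - y)"
    using d by (intro mult_left_mono) auto
  finally show "dist (inverse (max x d) ^ m) (inverse (max y d) ^ m) \<le> m / d ^ Suc m * dist x y"
    by (simp add: dist_norm)
qed (use d in auto)

text \<open>Truncating the force at \<open>\<delta>\<close> makes it globally Lipschitz; the solutions that are used
  stay above \<open>\<delta>\<close>.\<close>

lemma truncated_ode_exists:
  fixes a \<delta> :: real
  assumes "0 < \<delta>"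
  obtains s p where "s 0 = 1" "p 0 = 0"
    "\<And>t. 0 \<le> t \<Longrightarrow> (s has_real_derivative p t) (at t within {0..})"
    "\<And>t. 0 \<le> t \<Longrightarrow> (p has_real_derivative a * inverse (max (s t) \<delta>) ^ m) (at t within {0..})"
proof -
  define K where "K = m / \<delta> ^ Suc m"
  define F where "F = (\<lambda>y. (snd y, a * inverse (max (fst y) \<delta>) ^ m) :: real \<times> real)"
  have "(1 + \<bar>a\<bar> * K)-lipschitz_on UNIV F"
  proof (rule lipschitz_onI)
    fix y z :: "real \<times> real"
    have "dist (F y) (F z) \<le> dist (snd y) (snd z) +
        dist (a * inverse (max (fst y) \<delta>) ^ m) (a * inverse (max (fst z) \<delta>) ^ m)"
      unfolding F_def dist_Pair_Pair by (rule sqrt_sum_squares_le_sum) auto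
    also have "dist (a * inverse (max (fst y) \<delta>) ^ m) (a * inverse (max (fst z) \<delta>) ^ m)
        = \<bar>a\<bar> * dist (inverse (max (fst y) \<delta>) ^ m) (inverse (max (fst z) \<delta>) ^ m)"
      unfolding dist_real_def by (simp add: abs_mult flip: right_diff_distrib)
    also have "\<dots> \<le> \<bar>a\<bar> * (K * dist (fst y) (fst z))"
      unfolding K_def
      by (intro mult_left_mono lipschitz_onD[OF lipschitz_inverse_max_power[OF assms]]) auto
    also have "\<dots> \<le> \<bar>a\<bar> * (K * dist y z)"
      using assms by (intro mult_left_mono dist_fst_le) (auto simp: K_def)
    also have "dist (snd y) (snd z) \<le> dist y z" by (rule dist_snd_le)
    finally show "dist (F y) (F z) \<le> (1 + \<bar>a\<bar> * K) * dist y z" by (simp add: algebra_simps)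
  qed (use assms in \<open>auto simp: K_def\<close>)
  then obtain y where y: "y 0 = (1, 0)"
    "\<And>t. 0 \<le> t \<Longrightarrow> (y has_vector_derivative F (y t)) (at t within {0..})"
    using picard_lindeloef[of _ F "(1, 0)"] by blast
  show thesis
  proof (rule that[of "\<lambda>t. fst (y t)" "\<lambda>t. snd (y t)"])
    fix t :: real assume "0 \<le> t"
    note D = y(2)[OF this]
    show "((\<lambda>t. fst (y t)) has_real_derivative snd (y t)) (at t within {0..})"
      using bounded_linear.has_vector_derivative[OF bounded_linear_fst D]
      by (simp add: F_def has_real_derivative_iff_has_vector_derivative)
    show "((\<lambda>t. snd (y t)) has_real_derivative a * inverse (max (fst (y t)) \<delta>) ^ m) (at t within {0..})"
      using bounded_linear.has_vector_derivative[OF bounded_linear_snd D]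
      by (simp add: F_def has_real_derivative_iff_has_vector_derivative)
  qed (use y in auto)
qed

lemma mono_on_Ici:
  fixes f :: "real \<Rightarrow> real"
  assumes f: "\<And>x. x \<ge> 0 \<Longrightarrow> (f has_real_derivative f' x) (at x within {0..})"
    and "\<And>x. u < x \<Longrightarrow> x < t \<Longrightarrow> f' x \<ge> 0" and ut: "0 \<le> u" "u \<le> t"
  shows "f u \<le> f t"
proof (rule DERIV_nonneg_imp_increasing_open[where f = f and a = u and b = t])
  show "\<exists>y. (f has_real_derivative y) (at x) \<and> y \<ge> 0" if "u < x" "x < t" for x
    using f[of x] assms(2)[of x] that ut at_within_interior[of x "{0..}"] by auto
  have "continuous_on {0..} f" by (rule DERIV_continuous_on) (use f in auto)
  then show "continuous_on {u..t} f" by (rule continuous_on_subset) (use ut in auto)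
qed (rule ut)

text \<open>A positive force makes p nondecreasing from 0, so s is nondecreasing from 1. The
  truncation level 1 is therefore never crossed, and the truncated equation is the original
  one.\<close>

lemma expanding_ode_exists:
  fixes a :: real
  assumes "a > 0"
  obtains s p where "s 0 = 1" "p 0 = 0"
    "\<And>t. 0 \<le> t \<Longrightarrow> (s has_real_derivative p t) (at t within {0..})"
    "\<And>t. 0 \<le> t \<Longrightarrow> (p has_real_derivative a * inverse (s t) ^ m) (at t within {0..})"
    "\<And>t. 0 \<le> t \<Longrightarrow> s t \<ge> 1"
proof -
  obtain s p where sp: "s 0 = 1" "p 0 = 0"
    "\<And>t. 0 \<le> t \<Longrightarrow> (s has_real_derivative p t) (at t within {0..})"
    "\<And>t. 0 \<le> t \<Longrightarrow> (p has_real_derivative a * inverse (max (s t) 1) ^ m) (at t within {0..})"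
    using truncated_ode_exists[of 1 a m] by auto
  have "p 0 \<le> p t" if "t \<ge> 0" for t
    by (rule mono_on_Ici[OF sp(4)]) (use that assms in auto)
  then have p: "p t \<ge> 0" if "t \<ge> 0" for t using that sp(2) by simp
  have "s 0 \<le> s t" if "t \<ge> 0" for t
    by (rule mono_on_Ici[OF sp(3)]) (use that p in auto)
  then have s: "s t \<ge> 1" if "t \<ge> 0" for t using that sp(1) by simp
  show thesis
    by (rule that[OF sp(1-3)]) (use sp(4) s in \<open>auto simp: max_absorb1\<close>)
qed

text \<open>While s \<le> 1 the truncated force is at least b in size, so two integrations give s
  \<le> 1 - b t^2 / 2, which vanishes at sqrt (2 / b). The essential point is that this bound on T
  does not depend on \<delta>.\<close>

lemma collapsing_ode_exists:
  fixes b \<delta> :: real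
  assumes b: "b > 0" and \<delta>: "0 < \<delta>" "\<delta> < 1"
  obtains s p T where "s 0 = 1" "p 0 = 0" "0 \<le> T" "T \<le> sqrt (2 / b)" "s T = \<delta>"
    "\<And>t. t \<in> {0..T} \<Longrightarrow> (s has_real_derivative p t) (at t within {0..T})"
    "\<And>t. t \<in> {0..T} \<Longrightarrow> (p has_real_derivative - b * inverse (s t) ^ m) (at t within {0..T})"
    "\<And>t. t \<in> {0..T} \<Longrightarrow> s t \<ge> \<delta>"
proof -
  obtain s p where sp: "s 0 = 1" "p 0 = 0"
    "\<And>t. 0 \<le> t \<Longrightarrow> (s has_real_derivative p t) (at t within {0..})"
    "\<And>t. 0 \<le> t \<Longrightarrow> (p has_real_derivative - b * inverse (max (s t) \<delta>) ^ m) (at t within {0..})"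
    using truncated_ode_exists[OF \<delta>(1), of "- b" m] by blast
  have "- p 0 \<le> - p t" if "t \<ge> 0" for t
    by (rule mono_on_Ici[OF DERIV_minus[OF sp(4)]]) (use that b \<delta> in auto)
  then have p: "p t \<le> 0" if "t \<ge> 0" for t using that sp(2) by simp
  have anti: "- s u \<le> - s t" if "0 \<le> u" "u \<le> t" for u t
    by (rule mono_on_Ici[OF DERIV_minus[OF sp(3)]]) (use that p in auto)
  have s1: "s t \<le> 1" if "t \<ge> 0" for t using anti[of 0 t] that sp(1) by simp
  have "- p 0 - b * 0 \<le> - p t - b * t" if "t \<ge> 0" for t
  proof (rule mono_on_Ici[where f = "\<lambda>t. - p t - b * t"])
    show "((\<lambda>t. - p t - b * t) has_real_derivative - (- b * inverse (max (s x) \<delta>) ^ m) - b * 1) (at x within {0..})"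
      if "x \<ge> 0" for x
      using that by (intro DERIV_diff DERIV_minus DERIV_cmult DERIV_ident sp(4))
    fix x assume x: "0 < x" "x < t"
    then have "max (s x) \<delta> \<le> 1" "max (s x) \<delta> > 0" using s1[of x] \<delta> by auto
    then have "1 \<le> inverse (max (s x) \<delta>)" by (simp add: one_le_inverse_iff)
    then have "1 \<le> inverse (max (s x) \<delta>) ^ m" by (rule one_le_power)
    then show "0 \<le> - (- b * inverse (max (s x) \<delta>) ^ m) - b * 1" using b by simp
  qed (use that in auto)
  then have pb: "p t \<le> - b * t" if "t \<ge> 0" for t using that sp(2) by force
  have "- s 0 - b * 0\<^sup>2 / 2 \<le> - s t - b * t\<^sup>2 / 2" if "t \<ge> 0" for t
  proof (rule mono_on_Ici[where f = "\<lambda>t. - s t - b * t\<^sup>2 / 2"])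
    show "((\<lambda>t. - s t - b * t\<^sup>2 / 2) has_real_derivative - p x - b * x) (at x within {0..})"
      if "x \<ge> 0" for x
      using that by (auto intro!: derivative_eq_intros sp(3))
    show "0 \<le> - p x - b * x" if "0 < x" for x using pb[of x] that by simp
  qed (use that in auto)
  then have s2: "s t \<le> 1 - b * t\<^sup>2 / 2" if "t \<ge> 0" for t using that sp(1) by force
  have T0: "sqrt (2 / b) \<ge> 0" using b by simp
  have "s (sqrt (2 / b)) \<le> \<delta>" using s2[OF T0] b \<delta> by simp
  moreover have "continuous_on {0..} s" by (rule DERIV_continuous_on) (use sp(3) in auto)
  then have "continuous_on {0..sqrt (2 / b)} s" by (rule continuous_on_subset) auto
  ultimately obtain T where T: "0 \<le> T" "T \<le> sqrt (2 / b)" "s T = \<delta>"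
    using IVT2'[of s "sqrt (2 / b)" \<delta> 0] T0 sp(1) \<delta> by auto
  \<comment> \<open>s is nonincreasing, hence above its final value \<delta> throughout; the
    truncation never acts before T.\<close>
  have s\<delta>: "s t \<ge> \<delta>" if "t \<in> {0..T}" for t using anti[of t T] that T(3) by simp
  show thesis
  proof (rule that[where s = s and p = p and T = T, OF sp(1,2) T])
    fix t assume t: "t \<in> {0..T}"
    show "(s has_real_derivative p t) (at t within {0..T})"
      by (rule has_field_derivative_subset[OF sp(3)]) (use t in auto)
    have "(p has_real_derivative - b * inverse (max (s t) \<delta>) ^ m) (at t within {0..T})"
      by (rule has_field_derivative_subset[OF sp(4)]) (use t in auto)
    then show "(p has_real_derivative - b * inverse (s t) ^ m) (at t within {0..T})"
      using s\<delta>[OF t] by (simp add: max_absorb1)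
  qed (rule s\<delta>)
qed

section \<open>Solutions starting from a static uniform ball\<close>

text \<open>Compare through \<open>F t x\<close>: the uniform limit absorbs the change of time for
  all x at once, continuity of \<open>F t\<close> the change of x. This turns facts about curves in
  \<open>D_space\<close> into facts about functions of two variables.\<close>

lemma joint_continuous_on:
  fixes F :: "'a::metric_space \<Rightarrow> 'b::metric_space \<Rightarrow> 'c::metric_space"
  assumes cont: "\<And>t. t \<in> I \<Longrightarrow> continuous_on A (F t)"
    and lim: "\<And>t. t \<in> I \<Longrightarrow> uniform_limit A F (F t) (at t within I)"
  shows "continuous_on (I \<times> A) (\<lambda>(t, r). F t r)"
  unfolding continuous_on_iff
proof (intro ballI allI impI)
  fix y :: "'a \<times> 'b" and e :: real assume y: "y \<in> I \<times> A" and e: "0 < e"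
  obtain t r where [simp]: "y = (t, r)" by (cases y)
  have t: "t \<in> I" and r: "r \<in> A" using y by auto
  obtain d1 where d1: "d1 > 0" "\<forall>\<tau>\<in>I. 0 < dist \<tau> t \<and> dist \<tau> t < d1 \<longrightarrow>
      (\<forall>x\<in>A. dist (F \<tau> x) (F t x) < e / 2)"
    using uniform_limitD[OF lim[OF t] half_gt_zero[OF e]] unfolding eventually_at by auto
  obtain d2 where d2: "d2 > 0" "\<forall>x\<in>A. dist x r < d2 \<longrightarrow> dist (F t x) (F t r) < e / 2"
    using cont[OF t] r half_gt_zero[OF e] unfolding continuous_on_iff by blast
  show "\<exists>d>0. \<forall>z\<in>I \<times> A. dist z y < d \<longrightarrow>
      dist (case z of (t, r) \<Rightarrow> F t r) (case y of (t, r) \<Rightarrow> F t r) < e"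
  proof (intro exI[of _ "min d1 d2"] conjI ballI impI)
    fix z assume z: "z \<in> I \<times> A" "dist z y < min d1 d2"
    obtain \<tau> x where [simp]: "z = (\<tau>, x)" by (cases z)
    have "dist \<tau> t < d1" "dist x r < d2"
      using z(2) dist_fst_le[of z "(t, r)"] dist_snd_le[of z "(t, r)"] by auto
    then have "dist (F \<tau> x) (F t x) < e / 2" "dist (F t x) (F t r) < e / 2"
      using d1(2) d2(2) z(1) e r by (cases "\<tau> = t"; simp)+
    then show "dist (case z of (t, r) \<Rightarrow> F t r) (case y of (t, r) \<Rightarrow> F t r) < e"
      using dist_triangle[of "F \<tau> x" "F t r" "F t x"] by simp
  qed (use d1 d2 in auto)
qed

text \<open>Joint continuity of one partial derivative together with mere existence of the other at
  the point already yields total differentiability. Thus the time derivatives supplied by the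
  equations can be used without knowing their continuity along the curve.\<close>

lemma has_real_derivative_along_curve:
  fixes f fr :: "real \<Rightarrow> real \<Rightarrow> real"
  assumes ft: "((\<lambda>\<tau>. f \<tau> (Y t)) has_real_derivative ft) (at t within I)"
    and fr: "\<And>\<tau> r. \<tau> \<in> I \<Longrightarrow> r \<in> {a..b} \<Longrightarrow> (f \<tau> has_real_derivative fr \<tau> r) (at r)"
    and cont: "continuous_on (I \<times> {a..b}) (\<lambda>(\<tau>, r). fr \<tau> r)"
    and Y: "\<And>\<tau>. \<tau> \<in> I \<Longrightarrow> Y \<tau> \<in> {a..b}" "(Y has_real_derivative Y') (at t within I)"
    and t: "t \<in> I"
  shows "((\<lambda>\<tau>. f \<tau> (Y \<tau>)) has_real_derivative ft + fr t (Y t) * Y') (at t within I)"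
proof -
  have *: "((\<lambda>(x, y). f x y) has_derivative
       (\<lambda>(tx, ty). tx * ft + blinfun_apply (blinfun_mult_left (fr t (Y t))) ty)) (at (t, Y t) within I \<times> {a..b})"
  proof (rule has_derivative_partialsI[where fx = "\<lambda>tx. tx * ft" and
        fy = "\<lambda>x y. blinfun_mult_left (fr x y)"])
    show "((\<lambda>x. f x (Y t)) has_derivative (\<lambda>tx. tx * ft)) (at t within I)"
      using ft by (simp add: has_field_derivative_def mult_commute_abs)
    show "((f x) has_derivative blinfun_apply (blinfun_mult_left (fr x y))) (at y within {a..b})"
      if "x \<in> I" "y \<in> {a..b}" for x y
      using has_field_derivative_at_within[OF fr[OF that]]
      by (simp add: has_field_derivative_def mult_commute_abs)
    have "continuous_on (I \<times> {a..b}) (\<lambda>z. blinfun_mult_left (case z of (x, y) \<Rightarrow> fr x y))"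
      by (intro bounded_linear.continuous_on[OF bounded_linear_blinfun_mult_left] cont)
    then show "continuous (at (t, Y t) within I \<times> {a..b}) (\<lambda>(x, y). blinfun_mult_left (fr x y))"
      using t Y(1)[OF t] unfolding continuous_on_eq_continuous_within
      by (auto simp: case_prod_unfold)
  qed (use t Y in auto)
  have "((\<lambda>\<tau>. (\<tau>, Y \<tau>)) has_derivative (\<lambda>h. (h, h * Y'))) (at t within I)"
    using Y(2) by (auto intro!: derivative_eq_intros simp: has_field_derivative_def mult_commute_abs)
  moreover have "((\<lambda>(x, y). f x y) has_derivative
       (\<lambda>(tx, ty). tx * ft + blinfun_apply (blinfun_mult_left (fr t (Y t))) ty))
       (at (t, Y t) within (\<lambda>\<tau>. (\<tau>, Y \<tau>)) ` I)"
    by (rule has_derivative_subset[OF *]) (use Y(1) in auto)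
  ultimately have "((\<lambda>\<tau>. case (\<tau>, Y \<tau>) of (x, y) \<Rightarrow> f x y) has_derivative
      (\<lambda>h. case (h, h * Y') of (tx, ty) \<Rightarrow> tx * ft + blinfun_apply (blinfun_mult_left (fr t (Y t))) ty))
      (at t within I)"
    by (rule has_derivative_in_compose)
  then show ?thesis
    unfolding has_field_derivative_def prod.case
    by (rule has_derivative_eq_rhs) (auto simp: algebra_simps)
qed

text \<open>A Gronwall argument for the energy w^2 + \<mu>^2: it grows at a rate of at most K times
  itself, so after multiplication by exp (- K t) it is nonincreasing, and it starts at 0.\<close>

lemma linear_system_zero:
  fixes w \<mu> :: "real \<Rightarrow> real"
  assumes w: "\<And>t. t \<in> {0..T} \<Longrightarrow> (w has_real_derivative a t * w t + b t * \<mu> t) (at t within {0..T})"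
    and \<mu>: "\<And>t. t \<in> {0..T} \<Longrightarrow> (\<mu> has_real_derivative c t * w t) (at t within {0..T})"
    and cont: "continuous_on {0..T} a" "continuous_on {0..T} b" "continuous_on {0..T} c"
    and zero: "w 0 = 0" "\<mu> 0 = 0" and t: "t \<in> {0..T}"
  shows "w t = 0 \<and> \<mu> t = 0"
proof -
  \<comment> \<open>Growth rate of the energy: the term in w^2 contributes 2 |a|, and the mixed term
    (b + c) 2 w \<mu> contributes at most |b| + |c| because 2 |w \<mu>| \<le> w^2 + \<mu>^2.\<close>
  define k where "k = (\<lambda>t. 2 * \<bar>a t\<bar> + \<bar>b t\<bar> + \<bar>c t\<bar>)"
  have "continuous_on {0..T} k" unfolding k_def by (intro continuous_intros cont)
  then obtain K where K: "\<And>t. t \<in> {0..T} \<Longrightarrow> norm (k t) \<le> K"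
    using compact_continuous_image[THEN compact_imp_bounded, of "{0..T}" k]
    unfolding bounded_iff by (metis compact_Icc imageI)
  define E where "E = (\<lambda>t. ((w t)\<^sup>2 + (\<mu> t)\<^sup>2) * exp (- K * t))"
  have dw: "(w has_real_derivative a t * w t + b t * \<mu> t) (at t)"
    and d\<mu>: "(\<mu> has_real_derivative c t * w t) (at t)" if "0 < t" "t < T" for t
    using w[of t] \<mu>[of t] that by (auto simp: at_within_Icc_at)
  have "E t \<le> E 0"
  proof (rule DERIV_nonpos_imp_decreasing_open[where f = E and a = 0 and b = t])
    fix x assume x: "0 < x" "x < t"
    then have x': "0 < x" "x < T" using t by auto
    have ab: "2 * (w x * \<mu> x) \<le> (w x)\<^sup>2 + (\<mu> x)\<^sup>2" "- (2 * (w x * \<mu> x)) \<le> (w x)\<^sup>2 + (\<mu> x)\<^sup>2"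
      using zero_le_power2[of "w x - \<mu> x"] zero_le_power2[of "w x + \<mu> x"]
      by (simp_all add: power2_eq_square algebra_simps)
    then have ab': "\<bar>2 * (w x * \<mu> x)\<bar> \<le> (w x)\<^sup>2 + (\<mu> x)\<^sup>2" by linarith
    let ?D = "2 * w x * (a x * w x + b x * \<mu> x) + 2 * \<mu> x * (c x * w x)"
    have "(E has_real_derivative (?D - K * ((w x)\<^sup>2 + (\<mu> x)\<^sup>2)) * exp (- K * x)) (at x)"
      unfolding E_def using dw[OF x'] d\<mu>[OF x']
      by (auto intro!: derivative_eq_intros simp: algebra_simps)
    moreover have "?D \<le> K * ((w x)\<^sup>2 + (\<mu> x)\<^sup>2)"
    proof -
      have "?D = 2 * a x * (w x)\<^sup>2 + (b x + c x) * (2 * (w x * \<mu> x))"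
        by (simp add: algebra_simps power2_eq_square)
      also have "\<dots> \<le> 2 * \<bar>a x\<bar> * (w x)\<^sup>2 + \<bar>b x + c x\<bar> * \<bar>2 * (w x * \<mu> x)\<bar>"
        by (intro add_mono mult_right_mono) (auto simp flip: abs_mult)
      also have "\<dots> \<le> 2 * \<bar>a x\<bar> * ((w x)\<^sup>2 + (\<mu> x)\<^sup>2) + (\<bar>b x\<bar> + \<bar>c x\<bar>) * ((w x)\<^sup>2 + (\<mu> x)\<^sup>2)"
        by (intro add_mono mult_left_mono mult_mono ab') auto
      also have "\<dots> = k x * ((w x)\<^sup>2 + (\<mu> x)\<^sup>2)" by (simp add: k_def algebra_simps)
      also have "\<dots> \<le> K * ((w x)\<^sup>2 + (\<mu> x)\<^sup>2)"
        using K[of x] x' by (intro mult_right_mono) auto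
      finally show ?thesis .
    qed
    ultimately show "\<exists>y. (E has_real_derivative y) (at x) \<and> y \<le> 0"
      by (intro exI conjI) (auto intro: mult_nonpos_nonneg)
  next
    have "continuous_on {0..T} w" by (rule DERIV_continuous_on) (rule w)
    moreover have "continuous_on {0..T} \<mu>" by (rule DERIV_continuous_on) (rule \<mu>)
    ultimately have "continuous_on {0..T} E"
      unfolding E_def by (intro continuous_intros)
    then show "continuous_on {0..t} E" by (rule continuous_on_subset) (use t in auto)
  qed (use t in auto)
  also have "E 0 = 0" by (simp add: E_def zero)
  finally have "(w t)\<^sup>2 + (\<mu> t)\<^sup>2 \<le> 0" by (simp add: E_def mult_le_0_iff)
  then show ?thesis by (simp add: sum_power2_le_zero_iff)
qed


lemma has_integral_power_pred:
  fixes R :: real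
  assumes "n \<ge> 1" "R \<ge> 0"
  shows "((\<lambda>s. s ^ (n - 1)) has_integral R ^ n / n) {0..R}"
proof -
  have "((\<lambda>s. s ^ (n - 1)) has_integral R ^ n / n - 0 ^ n / n) {0..R}"
    using assms
    by (intro fundamental_theorem_of_calculus)
      (auto intro!: derivative_eq_intros simp flip: has_real_derivative_iff_has_vector_derivative)
  then show ?thesis using assms by (cases n) auto
qed

lemma at_within_Ici_neq_bot:
  assumes "t \<ge> 0"
  shows "at t within {0::real..} \<noteq> bot"
proof -
  have "at_right t \<le> at t within {0..}" using assms by (intro at_le) auto
  then show ?thesis by (metis bot_unique trivial_limit_at_right_real)
qed

lemma has_real_derivative_Ici_unique:
  fixes t :: real
  assumes "t \<ge> 0" "(f has_real_derivative D) (at t within {0..})" "(f has_real_derivative E) (at t within {0..})"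
  shows "D = E"
  using assms at_within_Ici_neq_bot unfolding has_field_derivative_iff by (blast intro: tendsto_unique)

section \<open>Behaviour of an arbitrary classical solution at the centre\<close>

text \<open>The regularity is common to \<open>has_global_solution\<close> and to the uniqueness
  class, so one analysis serves both nonexistence and uniqueness. With \<open>lam \<noteq> 0\<close>
  the momentum equation can detect a point charge.\<close>

locale classical_solution =
  fixes n :: nat and lam :: real and \<rho>0 v0 :: "real \<Rightarrow> real" and \<rho> v \<Phi> :: "real \<Rightarrow> real \<Rightarrow> real"
  assumes n: "n \<ge> 1" and lam: "lam \<noteq> 0"
    and \<rho>_curve: "\<rho> \<in> C_curves 1 {0..} 0" and v_curve: "v \<in> C_curves 1 {0..} 1"
    and EP: "radial_EP n lam \<rho>0 v0 \<rho> v \<Phi>"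
begin

lemma C_curve_0: "C_curve 0 0 {0..} \<rho>" "C_curve 0 1 {0..} v"
  using \<rho>_curve v_curve unfolding C_curves_def by (auto simp del: C_curve.simps simp flip: zero_enat_def)

lemma C_curve_1: "C_curve (Suc 0) 0 {0..} \<rho>" "C_curve (Suc 0) 1 {0..} v"
  using \<rho>_curve v_curve unfolding C_curves_def mem_Collect_eq one_enat_def
  by (metis One_nat_def order_refl)+

lemma \<rho>_continuous: "t \<ge> 0 \<Longrightarrow> continuous_on {0..} (\<rho> t)"
  using C_curve_0(1) by (simp add: D_space_def)

lemma v_continuous: "t \<ge> 0 \<Longrightarrow> continuous_on {0..} (v t)"
  using C_curve_0(2) by (simp add: D_space_def)

lemma \<rho>_joint_continuous: "continuous_on ({0..} \<times> {0..R}) (\<lambda>(t, r). \<rho> t r)"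
proof (rule joint_continuous_on)
  show "continuous_on {0..R} (\<rho> t)" if "t \<in> {0..}" for t
    using that by (intro continuous_on_subset[OF \<rho>_continuous]) auto
qed (use C_curve_0(1) in \<open>auto simp: D_tendsto_def\<close>)

lemma \<rho>_continuous_time: "r \<ge> 0 \<Longrightarrow> continuous_on {0..} (\<lambda>t. \<rho> t r)"
  by (rule continuous_on_compose2[OF \<rho>_joint_continuous, of _ "\<lambda>t. (t, r)" r, simplified])
    (auto intro!: continuous_intros)

lemma v_joint_continuous: "continuous_on ({0..} \<times> {0..R}) (\<lambda>(t, r). v t r)"
proof (rule joint_continuous_on)
  show "continuous_on {0..R} (v t)" if "t \<in> {0..}" for t
    using that by (intro continuous_on_subset[OF v_continuous]) auto
qed (use C_curve_0(2) in \<open>auto simp: D_tendsto_def\<close>)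

lemma v_has_deriv:
  assumes "t \<ge> 0" "r > 0"
  shows "(v t has_real_derivative deriv (v t) r) (at r)"
proof -
  have "v t \<in> D_space 1" using C_curve_0(2) assms(1) by simp
  then have "(deriv ^^ 0) (v t) differentiable (at r)"
    using assms(2) unfolding D_space_def
    by (metis (mono_tags, lifting) mem_Collect_eq zero_enat_def zero_less_one)
  then show ?thesis by (simp add: DERIV_deriv_iff_real_differentiable)
qed

text \<open>Derivatives converge only locally uniformly on (0,\<infinity>), whence the lower bound a
  > 0. The comparison curves R s(t) stay away from 0 on compact time intervals and so respect
  it.\<close>

lemma deriv_v_joint_continuous:
  assumes "a > 0"
  shows "continuous_on ({0..} \<times> {a..b}) (\<lambda>(t, r). deriv (v t) r)"
proof (rule joint_continuous_on)
  fix t :: real assume t: "t \<in> {0..}"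
  have "v t \<in> D_space 1" "D_tendsto 1 v (v t) (at t within {0..})" using C_curve_0(2) t by auto
  then have "continuous_on {0<..} ((deriv ^^ 1) (v t))"
    "uniform_limit {a..b} (\<lambda>x. (deriv ^^ 1) (v x)) ((deriv ^^ 1) (v t)) (at t within {0..})"
    using assms unfolding D_space_def D_tendsto_def mem_Collect_eq one_enat_def
    by (metis order_refl)+
  then show "continuous_on {a..b} (deriv (v t))"
    "uniform_limit {a..b} (\<lambda>x. deriv (v x)) (deriv (v t)) (at t within {0..})"
    using assms by (auto elim: continuous_on_subset)
qed

lemma mass_has_deriv:
  assumes "t \<ge> 0" "r > 0"
  shows "(mass n \<rho> t has_real_derivative \<rho> t r * r ^ (n - 1)) (at r)"
proof -
  have "((\<lambda>u. integral {0..u} (\<lambda>s. \<rho> t s * s ^ (n - 1))) has_real_derivative \<rho> t r * r ^ (n - 1)) (at r within {0..r+1})"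
    using assms by (intro integral_has_real_derivative)
      (auto intro!: continuous_intros continuous_on_subset[OF \<rho>_continuous])
  moreover have "at r within {0..r+1} = at r" using assms by (simp add: at_within_Icc_at)
  ultimately show ?thesis unfolding mass_def[abs_def] by simp
qed

lemma mass_has_time_deriv:
  assumes "t \<ge> 0" "r > 0"
  shows "((\<lambda>\<tau>. mass n \<rho> \<tau> r) has_real_derivative - v t r * (\<rho> t r * r ^ (n - 1))) (at t within {0..})"
proof -
  obtain mt mr where *: "((\<lambda>\<tau>. mass n \<rho> \<tau> r) has_real_derivative mt) (at t within {0..})"
     "(mass n \<rho> t has_real_derivative mr) (at r)" "mt + v t r * mr = 0"
    using EP assms unfolding radial_EP_def radial_mass_transport_def by blast
  have "mr = \<rho> t r * r ^ (n - 1)" using *(2) mass_has_deriv[OF assms] by (rule DERIV_unique)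
  with *(3) have "mt = - v t r * (\<rho> t r * r ^ (n - 1))" by simp
  with *(1) show ?thesis by simp
qed

text \<open>The gain is continuity of \<open>v' t\<close> down to r = 0, where the momentum equation
  is not imposed. The argument against a point charge uses it there.\<close>

lemma v_time_derivE:
  obtains v' where "\<And>t. t \<ge> 0 \<Longrightarrow> continuous_on {0..} (v' t)"
    "\<And>t r. t \<ge> 0 \<Longrightarrow> r \<ge> 0 \<Longrightarrow> ((\<lambda>\<tau>. v \<tau> r) has_real_derivative v' t r) (at t within {0..})"
proof -
  obtain v' where v': "\<forall>t\<in>{0..}. D_tendsto 1 (\<lambda>\<tau> r. (v \<tau> r - v t r) / (\<tau> - t)) (v' t) (at t within {0..})"
    "C_curve 0 1 {0..} v'"
    using C_curve_1(2) unfolding C_curve.simps(2) by blast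
  show thesis
  proof
    show "continuous_on {0..} (v' t)" if "t \<ge> 0" for t
      using v'(2) that by (simp add: D_space_def)
    show "((\<lambda>\<tau>. v \<tau> r) has_real_derivative v' t r) (at t within {0..})" if "t \<ge> 0" "r \<ge> 0" for t r
    proof -
      have "uniform_limit {0..r} (\<lambda>\<tau> r. (v \<tau> r - v t r) / (\<tau> - t)) (v' t) (at t within {0..})"
        using v'(1) that(1) unfolding D_tendsto_def by simp
      from tendsto_uniform_limitI[OF this, of r] that show ?thesis
        by (simp add: has_field_derivative_iff)
    qed
  qed
qed

text \<open>Uniformity in r allows this bound to be integrated over a small ball, which controls the
  change of mass.\<close>

lemma \<rho>_difference_bound:
  assumes "t \<ge> 0"
  obtains B where "B > 0"
    "\<forall>\<^sub>F \<tau> in at t within {0..}. \<forall>r\<in>{0..1}. \<bar>\<rho> \<tau> r - \<rho> t r\<bar> \<le> B * \<bar>\<tau> - t\<bar>"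
proof -
  obtain \<rho>' where \<rho>': "\<forall>t\<in>{0..}. D_tendsto 0 (\<lambda>\<tau> r. (\<rho> \<tau> r - \<rho> t r) / (\<tau> - t)) (\<rho>' t) (at t within {0..})"
    "C_curve 0 0 {0..} \<rho>'"
    using C_curve_1(1) unfolding C_curve.simps(2) by blast
  have "continuous_on {0..} (\<rho>' t)"
    using \<rho>'(2) assms by (simp add: D_space_def)
  then have "continuous_on {0..1} (\<rho>' t)"
    by (rule continuous_on_subset) auto
  from compact_imp_bounded[OF compact_continuous_image[OF this]]
  obtain B where B: "B > 0" "\<And>r. r \<in> {0..1} \<Longrightarrow> \<bar>\<rho>' t r\<bar> \<le> B"
    unfolding bounded_pos by auto
  have "uniform_limit {0..1} (\<lambda>\<tau> r. (\<rho> \<tau> r - \<rho> t r) / (\<tau> - t)) (\<rho>' t) (at t within {0..})"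
    using \<rho>'(1) assms unfolding D_tendsto_def by simp
  \<comment> \<open>Tolerance 1 in the uniform limit, hence the constant
    \<open>B + 1\<close>.\<close>
  from uniform_limitD[OF this zero_less_one]
  have "\<forall>\<^sub>F \<tau> in at t within {0..}. \<forall>r\<in>{0..1}. \<bar>\<rho> \<tau> r - \<rho> t r\<bar> \<le> (B + 1) * \<bar>\<tau> - t\<bar>"
  proof eventually_elim
    case (elim \<tau>)
    show ?case
    proof
      fix r :: real assume r: "r \<in> {0..1}"
      have "\<bar>(\<rho> \<tau> r - \<rho> t r) / (\<tau> - t)\<bar> \<le> B + 1"
        using bspec[OF elim r] B(2)[OF r] unfolding dist_real_def by linarith
      then show "\<bar>\<rho> \<tau> r - \<rho> t r\<bar> \<le> (B + 1) * \<bar>\<tau> - t\<bar>"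
        by (cases "\<tau> = t") (auto simp: abs_divide field_simps)
    qed
  qed
  with B(1) show thesis by (intro that[of "B + 1"]) auto
qed

text \<open>Since \<open>\<rho>\<close> is \<open>C\<^sup>1\<close> in time, \<open>m\<^sub>t = O(r\<^sup>n)\<close>, while \<open>m\<^sub>t = - v \<rho> r\<^bsup>n - 1\<^esup>\<close>.\<close>

lemma v_linear_bound:
  assumes t: "t \<ge> 0" and pos: "\<rho> t 0 > 0"
  shows "\<exists>C>0. \<exists>\<delta>>0. \<delta> \<le> 1 \<and> (\<forall>r. 0 < r \<and> r \<le> \<delta> \<longrightarrow> \<bar>v t r\<bar> \<le> C * r)"
proof -
  obtain B where B: "B > 0"
    "\<forall>\<^sub>F \<tau> in at t within {0..}. \<forall>r\<in>{0..1}. \<bar>\<rho> \<tau> r - \<rho> t r\<bar> \<le> B * \<bar>\<tau> - t\<bar>"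
    using \<rho>_difference_bound[OF t] .
  \<comment> \<open>The difference quotients of the mass converge to minus the flux, so their bound
    carries over. Replacing \<open>s ^ (n - 1)\<close> by \<open>r ^ (n - 1)\<close> under the
    integral is harmless, as only the order in r matters.\<close>
  have flux: "\<bar>v t r * (\<rho> t r * r ^ (n - 1))\<bar> \<le> B * r ^ (n - 1) * r" if r: "0 < r" "r \<le> 1" for r
  proof -
    have lim: "((\<lambda>\<tau>. (mass n \<rho> \<tau> r - mass n \<rho> t r) / (\<tau> - t)) \<longlongrightarrow> - v t r * (\<rho> t r * r ^ (n - 1))) (at t within {0..})"
      using mass_has_time_deriv[OF t r(1)] by (simp add: has_field_derivative_iff)
    have bound: "\<forall>\<^sub>F \<tau> in at t within {0..}. norm ((mass n \<rho> \<tau> r - mass n \<rho> t r) / (\<tau> - t)) \<le> B * r ^ (n - 1) * r"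
    proof -
      have "\<forall>\<^sub>F \<tau> in at t within {0..}. \<tau> \<in> {0..} \<and> \<tau> \<noteq> t"
        by (simp add: eventually_at_filter)
      with B(2) show ?thesis
      proof eventually_elim
        case (elim \<tau>)
        then have \<tau>: "\<tau> \<ge> 0" "\<tau> \<noteq> t" by auto
        have cont: "continuous_on {0..r} (\<lambda>s. \<rho> x s * s ^ (n - 1))" if "x \<ge> 0" for x
          using that by (auto intro!: continuous_intros continuous_on_subset[OF \<rho>_continuous])
        have "mass n \<rho> \<tau> r - mass n \<rho> t r = integral {0..r} (\<lambda>s. \<rho> \<tau> s * s ^ (n - 1) - \<rho> t s * s ^ (n - 1))"
          unfolding mass_def using cont[OF \<tau>(1)] cont[OF t]
          by (simp add: Henstock_Kurzweil_Integration.integral_diff integrable_continuous_real)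
        also have "norm \<dots> \<le> (B * \<bar>\<tau> - t\<bar> * r ^ (n - 1)) * (r - 0)"
        proof (rule integral_bound)
          fix s assume s: "s \<in> {0..r}"
          have "norm (\<rho> \<tau> s * s ^ (n - 1) - \<rho> t s * s ^ (n - 1)) = \<bar>\<rho> \<tau> s - \<rho> t s\<bar> * s ^ (n - 1)"
            using s by (simp add: abs_mult flip: left_diff_distrib)
          also have "\<dots> \<le> (B * \<bar>\<tau> - t\<bar>) * r ^ (n - 1)"
            using s r elim(1) B(1) by (intro mult_mono power_mono) auto
          finally show "norm (\<rho> \<tau> s * s ^ (n - 1) - \<rho> t s * s ^ (n - 1)) \<le> \<dots>" .
        qed (use r cont[OF \<tau>(1)] cont[OF t] in \<open>auto intro!: continuous_on_diff\<close>)
        finally show ?case using \<tau>(2) by (simp add: field_simps)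
      qed
    qed
    have "norm (- v t r * (\<rho> t r * r ^ (n - 1))) \<le> B * r ^ (n - 1) * r"
      by (rule tendsto_upperbound[OF tendsto_norm[OF lim] bound at_within_Ici_neq_bot[OF t]])
    then show ?thesis by simp
  qed
  have "continuous_on {0..} (\<rho> t)" using \<rho>_continuous[OF t] .
  \<comment> \<open>Near the centre the density exceeds half its central value and can be divided
    out of the flux; this gives the constant \<open>B / (\<rho> t 0 / 2)\<close>.\<close>
  then obtain d where d: "d > 0" "\<And>r. r \<in> {0..} \<Longrightarrow> dist r 0 < d \<Longrightarrow> dist (\<rho> t r) (\<rho> t 0) < \<rho> t 0 / 2"
    unfolding continuous_on_iff using half_gt_zero[OF pos] by (metis atLeast_iff order_refl)
  have "\<bar>v t r\<bar> \<le> B / (\<rho> t 0 / 2) * r" if r: "0 < r" "r \<le> min (d / 2) 1" for r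
  proof -
    have "\<rho> t r > \<rho> t 0 / 2"
      using d(2)[of r] r d(1) unfolding dist_real_def by (auto simp: abs_if split: if_splits)
    then have "\<bar>v t r\<bar> * (\<rho> t 0 / 2) \<le> \<bar>v t r\<bar> * \<rho> t r" by (intro mult_left_mono) auto
    also have "\<bar>v t r\<bar> * \<rho> t r \<le> B * r"
    proof -
      have "\<bar>v t r\<bar> * \<rho> t r * r ^ (n - 1) \<le> B * r * r ^ (n - 1)"
        using flux[of r] r \<open>\<rho> t r > \<rho> t 0 / 2\<close> pos by (simp add: abs_mult mult_ac)
      then show ?thesis using r(1) by simp
    qed
    finally show ?thesis
      using pos by (simp add: field_simps)
  qed
  then show ?thesis
    using d(1) B(1) pos
    by (intro exI[of _ "B / (\<rho> t 0 / 2)"] exI[of _ "min (d / 2) 1"] conjI allI impI) auto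
qed

lemma v_center_zero:
  assumes "t \<ge> 0" "\<rho> t 0 > 0"
  shows "v t 0 = 0"
proof -
  obtain C \<delta> where C: "\<delta> > 0" "\<delta> \<le> 1" "C > 0" "\<And>r. 0 < r \<Longrightarrow> r \<le> \<delta> \<Longrightarrow> \<bar>v t r\<bar> \<le> C * r"
    using v_linear_bound[OF assms] by blast
  have "\<forall>\<^sub>F r in at_right 0. norm (v t r) \<le> C * r"
    using eventually_at_right_less[of 0] eventually_at_rightI[of 0 \<delta> "\<lambda>r. r \<le> \<delta>"] C
    by (auto elim!: eventually_elim2)
  moreover have "((\<lambda>r. C * r) \<longlongrightarrow> 0) (at_right 0)"
    by (auto intro!: tendsto_eq_intros)
  ultimately have "(v t \<longlongrightarrow> 0) (at_right 0)"
    by (rule Lim_null_comparison)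
  moreover have "(v t \<longlongrightarrow> v t 0) (at 0 within {0..})"
    using v_continuous[OF assms(1)] by (simp add: continuous_on_def)
  then have "(v t \<longlongrightarrow> v t 0) (at_right 0)"
    by (rule tendsto_within_subset) auto
  ultimately show ?thesis by (intro tendsto_unique[of "at_right 0"]) auto
qed

text \<open>The functions r^(n-1) \<Phi>_r and \<open>mass n \<rho> t\<close> have the same
  derivative on (0,\<infinity>), so they differ by a constant. This c is the possible point charge
  at the origin.\<close>

lemma poisson_integrated:
  assumes "t \<ge> 0"
  obtains c where "\<And>r. r > 0 \<Longrightarrow> (\<Phi> t has_real_derivative (mass n \<rho> t r + c) / r ^ (n - 1)) (at r)"
proof -
  obtain \<Phi>r where \<Phi>r: "\<And>r. r > 0 \<Longrightarrow> (\<Phi> t has_real_derivative \<Phi>r r) (at r)"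
    "\<And>r. r > 0 \<Longrightarrow> ((\<lambda>s. s ^ (n - 1) * \<Phi>r s) has_real_derivative r ^ (n - 1) * \<rho> t r) (at r)"
    using EP assms unfolding radial_EP_def radial_poisson_def by metis
  have "((\<lambda>s. s ^ (n - 1) * \<Phi>r s - mass n \<rho> t s) has_real_derivative 0) (at r within {0<..})" if "r \<in> {0<..}" for r
    using DERIV_diff[OF \<Phi>r(2) mass_has_deriv[OF assms], of r] that
    by (simp add: has_field_derivative_at_within mult.commute)
  then obtain c where c: "\<And>s. s \<in> {0<..} \<Longrightarrow> s ^ (n - 1) * \<Phi>r s - mass n \<rho> t s = c"
    using has_field_derivative_zero_constant[of "{0<..}" "\<lambda>s. s ^ (n - 1) * \<Phi>r s - mass n \<rho> t s"] by auto
  show thesis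
  proof (rule that[of c])
    fix r :: real assume r: "r > 0"
    have "\<Phi>r r = (mass n \<rho> t r + c) / r ^ (n - 1)"
      using c[of r] r by (simp add: field_simps)
    then show "(\<Phi> t has_real_derivative (mass n \<rho> t r + c) / r ^ (n - 1)) (at r)"
      using \<Phi>r(1)[OF r] by simp
  qed
qed

text \<open>By continuity in time the central density remains positive near t, so the central
  velocity vanishes at all nearby times and its difference quotients are eventually 0.\<close>

lemma v_time_deriv_center:
  assumes t: "t \<ge> 0" and pos: "\<rho> t 0 > 0"
    and D: "((\<lambda>\<tau>. v \<tau> 0) has_real_derivative D) (at t within {0..})"
  shows "D = 0"
proof -
  have "((\<lambda>\<tau>. \<rho> \<tau> 0) \<longlongrightarrow> \<rho> t 0) (at t within {0..})"
    using \<rho>_continuous_time[of 0] t by (simp add: continuous_on_def)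
  then have ev: "\<forall>\<^sub>F \<tau> in at t within {0..}. \<rho> \<tau> 0 > 0"
    using pos by (rule order_tendstoD)
  have "\<forall>\<^sub>F \<tau> in at t within {0..}. \<tau> \<in> {0..}"
    by (simp add: eventually_at_filter)
  with ev have "\<forall>\<^sub>F \<tau> in at t within {0..}. (v \<tau> 0 - v t 0) / (\<tau> - t) = 0"
    by eventually_elim (use v_center_zero t pos in auto)
  then have "((\<lambda>\<tau>. (v \<tau> 0 - v t 0) / (\<tau> - t)) \<longlongrightarrow> 0) (at t within {0..})"
    by (rule tendsto_eventually)
  then show ?thesis
    using D at_within_Ici_neq_bot[OF t] unfolding has_field_derivative_iff by (blast intro: tendsto_unique)
qed

lemma mass_bound:
  assumes "t \<ge> 0"
  obtains M where "M > 0" "\<And>r. 0 < r \<Longrightarrow> r \<le> 1 \<Longrightarrow> \<bar>mass n \<rho> t r\<bar> \<le> M * r ^ (n - 1) * r"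
proof -
  have "continuous_on {0..1} (\<rho> t)"
    using \<rho>_continuous[OF assms] by (rule continuous_on_subset) auto
  from compact_imp_bounded[OF compact_continuous_image[OF this]]
  obtain M where M: "M > 0" "\<And>r. r \<in> {0..1} \<Longrightarrow> \<bar>\<rho> t r\<bar> \<le> M"
    unfolding bounded_pos by auto
  have "\<bar>mass n \<rho> t r\<bar> \<le> M * r ^ (n - 1) * r" if r: "0 < r" "r \<le> 1" for r
  proof -
    have "norm (mass n \<rho> t r) \<le> (M * r ^ (n - 1)) * (r - 0)"
      unfolding mass_def
    proof (rule integral_bound)
      show "continuous_on {0..r} (\<lambda>s. \<rho> t s * s ^ (n - 1))"
        using assms by (auto intro!: continuous_intros continuous_on_subset[OF \<rho>_continuous])
      fix s assume s: "s \<in> {0..r}"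
      have "norm (\<rho> t s * s ^ (n - 1)) = \<bar>\<rho> t s\<bar> * s ^ (n - 1)" using s by (simp add: abs_mult)
      also have "\<dots> \<le> M * r ^ (n - 1)"
        using s r M by (intro mult_mono power_mono) auto
      finally show "norm (\<rho> t s * s ^ (n - 1)) \<le> \<dots>" .
    qed (use r in auto)
    then show ?thesis by simp
  qed
  with M(1) show thesis using that by blast
qed

text \<open>The constant of integration in the Poisson equation vanishes: otherwise the momentum
  equation would make \<open>v\<^sup>2\<close> grow at least linearly at the centre, contradicting \<open>v = O(r)\<close>.\<close>

lemma regular_center_derivs:
  assumes t: "t \<ge> 0" and pos: "\<rho> t 0 > 0"
  shows "r > 0 \<Longrightarrow> (\<Phi> t has_real_derivative mass n \<rho> t r / r ^ (n - 1)) (at r)"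
    and "r > 0 \<Longrightarrow> ((\<lambda>\<tau>. v \<tau> r) has_real_derivative
           - (v t r * deriv (v t) r) - lam * (mass n \<rho> t r / r ^ (n - 1))) (at t within {0..})"
proof -
  obtain c where c: "\<And>r. r > 0 \<Longrightarrow> (\<Phi> t has_real_derivative (mass n \<rho> t r + c) / r ^ (n - 1)) (at r)"
    using poisson_integrated[OF t] by blast
  obtain v' where v': "\<And>t. t \<ge> 0 \<Longrightarrow> continuous_on {0..} (v' t)"
    "\<And>t r. t \<ge> 0 \<Longrightarrow> r \<ge> 0 \<Longrightarrow> ((\<lambda>\<tau>. v \<tau> r) has_real_derivative v' t r) (at t within {0..})"
    using v_time_derivE by blast
  have mom: "v' t r + v t r * deriv (v t) r + lam * ((mass n \<rho> t r + c) / r ^ (n - 1)) = 0" if r: "r > 0" for r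
  proof -
    obtain a b d where *: "((\<lambda>\<tau>. v \<tau> r) has_real_derivative a) (at t within {0..})"
      "(v t has_real_derivative b) (at r)" "(\<Phi> t has_real_derivative d) (at r)"
      "a + v t r * b + lam * d = 0"
      using EP t r unfolding radial_EP_def radial_momentum_def by blast
    have "a = v' t r" using has_real_derivative_Ici_unique[OF t *(1) v'(2)] t r by simp
    moreover have "b = deriv (v t) r" using *(2) by (simp add: DERIV_imp_deriv)
    moreover have "d = (mass n \<rho> t r + c) / r ^ (n - 1)" using *(3) c[OF r] by (rule DERIV_unique)
    ultimately show ?thesis using *(4) by simp
  qed
  have "c = 0"
  proof (rule ccontr)
    assume "c \<noteq> 0"
    \<comment> \<open>The sign \<sigma> makes \<open>\<sigma> * (lam * c)\<close> equal to k > 0, so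
      attractive and repulsive charges are treated together.\<close>
    define k where "k = \<bar>lam * c\<bar>"
    have k: "k > 0" using \<open>c \<noteq> 0\<close> lam by (simp add: k_def)
    define \<sigma> where "\<sigma> = sgn (lam * c)"
    have \<sigma>: "\<bar>\<sigma>\<bar> = 1" "\<sigma> * (lam * c) = k"
      using \<open>c \<noteq> 0\<close> lam by (auto simp: \<sigma>_def k_def abs_sgn_eq abs_mult_self mult.commute[of "sgn _"] abs_sgn[symmetric])
    obtain C \<delta> where C: "\<delta> > 0" "\<delta> \<le> 1" "C > 0" "\<And>r. 0 < r \<Longrightarrow> r \<le> \<delta> \<Longrightarrow> \<bar>v t r\<bar> \<le> C * r"
      using v_linear_bound[OF t pos] by auto
    obtain M where M: "M > 0" "\<And>r. 0 < r \<Longrightarrow> r \<le> 1 \<Longrightarrow> \<bar>mass n \<rho> t r\<bar> \<le> M * r ^ (n - 1) * r"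
      using mass_bound[OF t] by blast
    have "v' t 0 = 0" using v_time_deriv_center[OF t pos v'(2)] t by simp
    moreover have "k / 4 > 0" using k by simp
    ultimately obtain d where d: "d > 0" "\<And>r. r \<in> {0..} \<Longrightarrow> dist r 0 < d \<Longrightarrow> dist (v' t r) 0 < k / 4"
      using v'(1)[OF t] unfolding continuous_on_iff by (metis atLeast_iff order_refl)
    \<comment> \<open>The four bounds serve in turn: v = O(r) is available; the local acceleration
      is below k / 4; the force of the regular mass, at most |lam| M r, is also below k / 4; and C^2
      R \<le> k / 2, which contradicts the final estimate.\<close>
    define R where "R = min (min \<delta> (d / 2)) (min (k / (4 * (\<bar>lam\<bar> * M))) (k / (2 * C\<^sup>2)))"
    have lM: "\<bar>lam\<bar> * M > 0" using lam M(1) by simp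
    have R: "0 < R" "R \<le> \<delta>" "R < d" "R \<le> k / (4 * (\<bar>lam\<bar> * M))" "R \<le> k / (2 * C\<^sup>2)"
    proof -
      show "0 < R" using C d(1) k lM by (simp add: R_def)
      have "R \<le> d / 2" by (simp add: R_def)
      then show "R < d" using d(1) by simp
    qed (simp_all add: R_def)
    have g: "\<bar>v' t r + lam * (mass n \<rho> t r / r ^ (n - 1))\<bar> \<le> k / 2" if r: "0 < r" "r \<le> R" for r
    proof -
      have "\<bar>v' t r\<bar> \<le> k / 4" using d(2)[of r] r R by simp
      moreover have "\<bar>lam * (mass n \<rho> t r / r ^ (n - 1))\<bar> \<le> k / 4"
      proof -
        have "\<bar>mass n \<rho> t r / r ^ (n - 1)\<bar> \<le> M * r"
          using M(2)[of r] r R C(2) by (simp add: abs_divide field_simps)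
        then have "\<bar>lam * (mass n \<rho> t r / r ^ (n - 1))\<bar> \<le> \<bar>lam\<bar> * (M * r)"
          unfolding abs_mult by (intro mult_left_mono) auto
        also have "\<dots> \<le> \<bar>lam\<bar> * M * R" using r M(1) by (simp add: mult_left_mono mult.assoc)
        also have "\<dots> \<le> k / 4" using R(4) lM by (simp add: field_simps)
        finally show ?thesis .
      qed
      ultimately have "\<bar>v' t r\<bar> + \<bar>lam * (mass n \<rho> t r / r ^ (n - 1))\<bar> \<le> k / 4 + k / 4"
        by (rule add_mono)
      then show ?thesis by (intro order_trans[OF abs_triangle_ineq]) simp
    qed
    \<comment> \<open>Since (v^2 / 2)_r = v v_r, the momentum equation gives \<sigma> (v^2 / 2)_r
      \<le> k / 2 - k / r^(n-1) \<le> - k / 2, so W decreases from W 0 = 0. Hence v^2 \<ge> k R at r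
      = R, against v^2 \<le> C^2 R^2. Only r^(n-1) \<le> 1 enters, which covers n = 1 too.\<close>
    define W where "W = (\<lambda>r. \<sigma> * ((v t r)\<^sup>2 / 2) + k / 2 * r)"
    have "W R \<le> W 0"
    proof (rule DERIV_nonpos_imp_decreasing_open[where f = W and a = 0 and b = R])
      show "continuous_on {0..R} W"
        unfolding W_def using t by (intro continuous_intros continuous_on_subset[OF v_continuous]) auto
      fix r assume r: "0 < r" "r < R"
      have r1: "r ^ (n - 1) \<le> 1" using r R C(2) by (intro power_le_one) auto
      have "(W has_real_derivative \<sigma> * (v t r * deriv (v t) r) + k / 2) (at r)"
        unfolding W_def by (auto intro!: derivative_eq_intros v_has_deriv t r simp: mult_ac)
      moreover have "\<sigma> * (v t r * deriv (v t) r) + k / 2 \<le> 0"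
      proof -
        have "v t r * deriv (v t) r = - (v' t r + lam * (mass n \<rho> t r / r ^ (n - 1))) - lam * c / r ^ (n - 1)"
          using mom[OF r(1)] by (simp add: add_divide_distrib distrib_left)
        then have "\<sigma> * (v t r * deriv (v t) r) =
            - (\<sigma> * (v' t r + lam * (mass n \<rho> t r / r ^ (n - 1)))) - \<sigma> * (lam * c) / r ^ (n - 1)"
          by (simp only: right_diff_distrib mult_minus_right times_divide_eq_right)
        also have "\<dots> \<le> k / 2 - k / r ^ (n - 1)"
        proof -
          have "\<bar>\<sigma> * (v' t r + lam * (mass n \<rho> t r / r ^ (n - 1)))\<bar> \<le> k / 2"
            using g[of r] r by (simp add: abs_mult \<sigma>(1))
          then show ?thesis unfolding \<sigma>(2) by linarith
        qed
        also have "\<dots> \<le> k / 2 - k"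
          using r1 r(1) k by (simp add: field_simps)
        finally show ?thesis by simp
      qed
      ultimately show "\<exists>y. (W has_real_derivative y) (at r) \<and> y \<le> 0" by blast
    qed (use R in auto)
    also have "W 0 = 0" by (simp add: W_def v_center_zero[OF t pos])
    finally have "k / 2 * R \<le> \<bar>\<sigma> * ((v t R)\<^sup>2 / 2)\<bar>" unfolding W_def by linarith
    also have "\<dots> = (v t R)\<^sup>2 / 2" by (simp add: abs_mult \<sigma>(1))
    also have "\<dots> \<le> (C * R)\<^sup>2 / 2"
      using C(4)[of R] R by (intro divide_right_mono) (auto simp: abs_le_square_iff[symmetric])
    finally have "k * R \<le> (C\<^sup>2 * R) * R" by (simp add: power2_eq_square mult_ac)
    then have "k \<le> C\<^sup>2 * R" using R(1) by simp
    also have "\<dots> \<le> k / 2" using R(5) C(3) by (simp add: field_simps)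
    finally show False using k by simp
  qed
  then show "r > 0 \<Longrightarrow> (\<Phi> t has_real_derivative mass n \<rho> t r / r ^ (n - 1)) (at r)"
    using c by simp
  assume r: "r > 0"
  have "v' t r = - (v t r * deriv (v t) r) - lam * (mass n \<rho> t r / r ^ (n - 1))"
    using mom[OF r] \<open>c = 0\<close> by simp
  then show "((\<lambda>\<tau>. v \<tau> r) has_real_derivative
           - (v t r * deriv (v t) r) - lam * (mass n \<rho> t r / r ^ (n - 1))) (at t within {0..})"
    using v'(2)[of t r] t r by simp
qed

end

section \<open>Rigidity: the static uniform data determine the solution\<close>

locale static_start = classical_solution n lam "\<lambda>_. \<rho>c" "\<lambda>_. 0" \<rho> v \<Phi>
  for n lam \<rho>c \<rho> v \<Phi> +
  assumes \<rho>c: "\<rho>c > 0"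
begin

text \<open>Characteristics need not be constructed: along the explicit curves \<open>t \<mapsto> R s(t)\<close> the velocity
  defect and the mass defect solve a homogeneous linear system with zero initial data.\<close>

lemma flow_if_center_positive:
  fixes s p :: "real \<Rightarrow> real"
  assumes s: "\<And>t. t \<in> {0..T} \<Longrightarrow> (s has_real_derivative p t) (at t within {0..T})"
    and p: "\<And>t. t \<in> {0..T} \<Longrightarrow>
      (p has_real_derivative - (lam * \<rho>c / n) * inverse (s t) ^ (n - 1)) (at t within {0..T})"
    and s_pos: "\<And>t. t \<in> {0..T} \<Longrightarrow> s t > 0" and init: "s 0 = 1" "p 0 = 0"
    and pos: "\<And>t. t \<in> {0..T} \<Longrightarrow> \<rho> t 0 > 0"
    and t: "t \<in> {0..T}" and r: "r > 0"
  shows "v t r = r * p t / s t" "mass n \<rho> t r = \<rho>c * (r / s t) ^ n / n"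
proof -
  \<comment> \<open>The label of the comparison curve that passes through r at time t.\<close>
  define R where "R = r / s t"
  have R: "R > 0" using r s_pos[OF t] by (simp add: R_def)
  define Y where "Y = (\<lambda>t. R * s t)"
  have Yt: "Y t = r" using s_pos[OF t] by (simp add: Y_def R_def)
  have Y_pos: "Y x > 0" if "x \<in> {0..T}" for x using R s_pos[OF that] by (simp add: Y_def)
  have dY: "(Y has_real_derivative R * p x) (at x within {0..T})" if "x \<in> {0..T}" for x
    unfolding Y_def by (intro DERIV_cmult s that)
  have contY: "continuous_on {0..T} Y" by (rule DERIV_continuous_on) (rule dY)
  have T: "{0..T} \<noteq> {}" using t by auto
  obtain y1 where y1: "y1 \<in> {0..T}" "\<And>x. x \<in> {0..T} \<Longrightarrow> Y y1 \<le> Y x"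
    using continuous_attains_inf[OF compact_Icc T contY] by blast
  obtain y2 where y2: "y2 \<in> {0..T}" "\<And>x. x \<in> {0..T} \<Longrightarrow> Y x \<le> Y y2"
    using continuous_attains_sup[OF compact_Icc T contY] by blast
  define a b where "a = Y y1" and "b = Y y2"
  have a: "a > 0" using Y_pos[OF y1(1)] by (simp add: a_def)
  have Y_in: "Y x \<in> {a..b}" if "x \<in> {0..T}" for x using y1(2)[OF that] y2(2)[OF that] by (simp add: a_def b_def)
  have cont_dv: "continuous_on ({0..T} \<times> {a..b}) (\<lambda>(t, r). deriv (v t) r)"
    by (rule continuous_on_subset[OF deriv_v_joint_continuous[OF a, of b]]) auto
  have "continuous_on ({0..T} \<times> {a..b}) (\<lambda>(t, r). \<rho> t r)"
    by (rule continuous_on_subset[OF \<rho>_joint_continuous[of b]]) (use a in auto)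
  then have cont_dm: "continuous_on ({0..T} \<times> {a..b}) (\<lambda>(t, r). \<rho> t r * r ^ (n - 1))"
    by (auto simp: case_prod_unfold intro!: continuous_intros)
  have contYpair: "continuous_on {0..T} (\<lambda>x. (x, Y x))" "(\<lambda>x. (x, Y x)) ` {0..T} \<subseteq> {0..T} \<times> {a..b}"
    using contY Y_in by (auto intro!: continuous_intros)
  \<comment> \<open>Defects of velocity and mass along the curve. The explicit mass inside R s(t) is
    constantly \<rho>c R^n / n. In the derivative of w the transport terms combine to - v_r (v - R
    p), and in that of \<mu> to - \<rho> Y^(n-1) (v - R p), so both are driven by defects
    alone.\<close>
  define w where "w = (\<lambda>t. v t (Y t) - R * p t)"
  define \<mu> where "\<mu> = (\<lambda>t. mass n \<rho> t (Y t) - \<rho>c * R ^ n / n)"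
  have "w t = 0 \<and> \<mu> t = 0"
  proof (rule linear_system_zero[where w = w and \<mu> = \<mu> and t = t and T = T and a = "\<lambda>x. - deriv (v x) (Y x)"
        and b = "\<lambda>x. - lam / Y x ^ (n - 1)" and c = "\<lambda>x. - (\<rho> x (Y x) * Y x ^ (n - 1))"])
    fix x assume x: "x \<in> {0..T}"
    then have x0: "x \<ge> 0" by simp
    let ?D = "- (v x (Y x) * deriv (v x) (Y x)) - lam * (mass n \<rho> x (Y x) / Y x ^ (n - 1))"
    have "((\<lambda>\<tau>. v \<tau> (Y \<tau>)) has_real_derivative ?D + deriv (v x) (Y x) * (R * p x)) (at x within {0..T})"
    proof (rule has_real_derivative_along_curve[where f = v and fr = "\<lambda>t. deriv (v t)" and Y = Y,
        OF _ _ cont_dv Y_in dY[OF x] x])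
      show "((\<lambda>\<tau>. v \<tau> (Y x)) has_real_derivative ?D) (at x within {0..T})"
        by (rule has_field_derivative_subset[OF regular_center_derivs(2)[OF x0 pos[OF x] Y_pos[OF x]]]) auto
    qed (use a in \<open>auto intro!: v_has_deriv\<close>)
    then have "(w has_real_derivative ?D + deriv (v x) (Y x) * (R * p x)
        - R * (- (lam * \<rho>c / n) * inverse (s x) ^ (n - 1))) (at x within {0..T})"
      unfolding w_def by (intro DERIV_diff DERIV_cmult p x)
    \<comment> \<open>The equation of s says that the acceleration R p' of the curve is the force
      exerted at radius Y by the explicit mass; subtracting it leaves the force of the mass defect
      \<mu>.\<close>
    moreover have "R * ((lam * \<rho>c / n) * inverse (s x) ^ (n - 1)) = lam / Y x ^ (n - 1) * (\<rho>c * R ^ n / n)"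
    proof -
      have "R ^ n = R * R ^ (n - 1)" using n by (cases n) auto
      then show ?thesis using R s_pos[OF x] n by (simp add: Y_def power_mult_distrib field_simps)
    qed
    ultimately show "(w has_real_derivative - deriv (v x) (Y x) * w x + - lam / Y x ^ (n - 1) * \<mu> x) (at x within {0..T})"
      by (simp add: w_def \<mu>_def algebra_simps)
    have "((\<lambda>\<tau>. mass n \<rho> \<tau> (Y \<tau>)) has_real_derivative
        - v x (Y x) * (\<rho> x (Y x) * Y x ^ (n - 1)) + (\<rho> x (Y x) * Y x ^ (n - 1)) * (R * p x)) (at x within {0..T})"
    proof (rule has_real_derivative_along_curve[where f = "mass n \<rho>" and fr = "\<lambda>t r. \<rho> t r * r ^ (n - 1)" and Y = Y,
        OF _ _ cont_dm Y_in dY[OF x] x])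
      show "((\<lambda>\<tau>. mass n \<rho> \<tau> (Y x)) has_real_derivative - v x (Y x) * (\<rho> x (Y x) * Y x ^ (n - 1))) (at x within {0..T})"
        by (rule has_field_derivative_subset[OF mass_has_time_deriv[OF x0 Y_pos[OF x]]]) auto
      show "(mass n \<rho> \<tau> has_real_derivative \<rho> \<tau> r * r ^ (n - 1)) (at r)" if "\<tau> \<in> {0..T}" "r \<in> {a..b}" for \<tau> r
        using that a by (intro mass_has_deriv) auto
    qed auto
    then have "(\<mu> has_real_derivative - v x (Y x) * (\<rho> x (Y x) * Y x ^ (n - 1))
        + (\<rho> x (Y x) * Y x ^ (n - 1)) * (R * p x) - 0) (at x within {0..T})"
      unfolding \<mu>_def by (intro DERIV_diff DERIV_const)
    then show "(\<mu> has_real_derivative - (\<rho> x (Y x) * Y x ^ (n - 1)) * w x) (at x within {0..T})"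
      by (simp add: w_def algebra_simps)
  next
    show "continuous_on {0..T} (\<lambda>x. - deriv (v x) (Y x))"
      using continuous_on_compose2[OF cont_dv contYpair] by (auto intro: continuous_on_minus)
    show "continuous_on {0..T} (\<lambda>x. - (\<rho> x (Y x) * Y x ^ (n - 1)))"
      using continuous_on_compose2[OF cont_dm contYpair] by (auto intro: continuous_on_minus)
    show "continuous_on {0..T} (\<lambda>x. - lam / Y x ^ (n - 1))"
      using Y_pos by (intro continuous_intros contY) force
    have ini: "\<rho> 0 y = \<rho>c" "v 0 y = 0" if "y \<ge> 0" for y
      using EP that unfolding radial_EP_def by auto
    show "w 0 = 0" using R by (simp add: w_def init Y_def ini)
    have "mass n \<rho> 0 R = integral {0..R} (\<lambda>s. \<rho>c * s ^ (n - 1))"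
      unfolding mass_def by (intro integral_cong) (auto simp: ini)
    also have "\<dots> = \<rho>c * (R ^ n / n)"
      using has_integral_mult_right[OF has_integral_power_pred[OF n, of R]] R by (intro integral_unique) auto
    finally show "\<mu> 0 = 0" by (simp add: \<mu>_def Y_def init)
  qed (rule t)
  then show "v t r = r * p t / s t" "mass n \<rho> t r = \<rho>c * (r / s t) ^ n / n"
    unfolding w_def \<mu>_def Yt by (auto simp: R_def)
qed

text \<open>For r > 0 the density is recovered by differentiating the mass in r; continuity of
  \<open>\<rho> t\<close> then reaches r = 0, the value needed to propagate positivity.\<close>

lemma density_if_center_positive:
  fixes s p :: "real \<Rightarrow> real"
  assumes s: "\<And>t. t \<in> {0..T} \<Longrightarrow> (s has_real_derivative p t) (at t within {0..T})"
    and p: "\<And>t. t \<in> {0..T} \<Longrightarrow>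
      (p has_real_derivative - (lam * \<rho>c / n) * inverse (s t) ^ (n - 1)) (at t within {0..T})"
    and s_pos: "\<And>t. t \<in> {0..T} \<Longrightarrow> s t > 0" and init: "s 0 = 1" "p 0 = 0"
    and pos: "\<And>t. t \<in> {0..T} \<Longrightarrow> \<rho> t 0 > 0"
    and t: "t \<in> {0..T}" and r: "r \<ge> 0"
  shows "\<rho> t r = \<rho>c / s t ^ n"
proof -
  note flow = flow_if_center_positive[OF s p s_pos init pos t]
  have st: "s t > 0" by (rule s_pos[OF t])
  have pos_r: "\<rho> t r = \<rho>c / s t ^ n" if r: "r \<in> {0<..}" for r
  proof -
    have D: "(mass n \<rho> t has_real_derivative \<rho> t r * r ^ (n - 1)) (at r)"
      using mass_has_deriv t r by simp
    have "((\<lambda>r. \<rho>c * (r / s t) ^ n / n) has_real_derivative (\<rho>c / s t ^ n) * r ^ (n - 1)) (at r)"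
      using n st by (auto intro!: derivative_eq_intros simp: power_divide field_simps simp flip: power_Suc)
    then have "(mass n \<rho> t has_real_derivative (\<rho>c / s t ^ n) * r ^ (n - 1)) (at r)"
      by (rule has_field_derivative_transform_within_open[where S = "{0<..}"]) (use r flow(2) in auto)
    from DERIV_unique[OF D this] show ?thesis
      using r by (subst (asm) mult_right_cancel) auto
  qed
  show ?thesis
  proof (rule continuous_constant_on_closure[where S = "{0<..}" and f = "\<rho> t" and x = r])
    show "continuous_on (closure {0<..}) (\<rho> t)"
      using \<rho>_continuous[of t] t by simp
  qed (use pos_r r in auto)
qed

lemma center_positive:
  fixes s p :: "real \<Rightarrow> real"
  assumes s: "\<And>t. t \<in> {0..T} \<Longrightarrow> (s has_real_derivative p t) (at t within {0..T})"
    and p: "\<And>t. t \<in> {0..T} \<Longrightarrow>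
      (p has_real_derivative - (lam * \<rho>c / n) * inverse (s t) ^ (n - 1)) (at t within {0..T})"
    and s_pos: "\<And>t. t \<in> {0..T} \<Longrightarrow> s t > 0" and init: "s 0 = 1" "p 0 = 0"
    and t: "t \<in> {0..T}"
  shows "\<rho> t 0 > 0"
proof (rule ccontr)
  assume "\<not> \<rho> t 0 > 0"
  define S where "S = {t \<in> {0..T}. \<rho> t 0 \<in> {..0}}"
  have cont: "continuous_on {0..T} (\<lambda>t. \<rho> t 0)"
    by (rule continuous_on_subset[OF \<rho>_continuous_time[of 0]]) auto
  have "closed ({0..T} \<inter> (\<lambda>t. \<rho> t 0) -` {..0})"
    by (intro continuous_closed_preimage cont) auto
  then have "compact ({0..T} \<inter> ({0..T} \<inter> (\<lambda>t. \<rho> t 0) -` {..0}))"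
    by (intro compact_Int_closed compact_Icc)
  also have "{0..T} \<inter> ({0..T} \<inter> (\<lambda>t. \<rho> t 0) -` {..0}) = S" by (auto simp: S_def)
  finally have "compact S" .
  have "S \<noteq> {}" using t \<open>\<not> \<rho> t 0 > 0\<close> by (auto simp: S_def)
  obtain t1 where t1: "t1 \<in> S" "\<And>x. x \<in> S \<Longrightarrow> t1 \<le> x"
    using compact_attains_inf[OF \<open>compact S\<close> \<open>S \<noteq> {}\<close>] by auto
  have "\<rho> 0 0 = \<rho>c" using EP unfolding radial_EP_def by simp
  then have "t1 \<noteq> 0" using t1(1) \<rho>c by (auto simp: S_def)
  then have t1T: "0 < t1" "t1 \<le> T" using t1(1) by (auto simp: S_def)
  have before: "\<rho> x 0 - \<rho>c / s x ^ n = 0" if x: "x \<in> {0..<t1}" for x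
  proof -
    have xT: "{0..x} \<subseteq> {0..T}" using x t1T by auto
    have "\<rho> x 0 = \<rho>c / s x ^ n"
    proof (rule density_if_center_positive[where T = x and s = s and p = p])
      show "(s has_real_derivative p y) (at y within {0..x})" if "y \<in> {0..x}" for y
        using has_field_derivative_subset[OF s xT] that xT by blast
      show "(p has_real_derivative - (lam * \<rho>c / n) * inverse (s y) ^ (n - 1)) (at y within {0..x})"
        if "y \<in> {0..x}" for y
        using has_field_derivative_subset[OF p xT] that xT by blast
      show "\<rho> y 0 > 0" if "y \<in> {0..x}" for y
        using t1(2)[of y] that x xT by (force simp: S_def)
    qed (use x xT s_pos init in auto)
    then show ?thesis by simp
  qed
  have "continuous_on {0..T} s" by (rule DERIV_continuous_on) (rule s)
  then have "continuous_on {0..T} (\<lambda>x. \<rho> x 0 - \<rho>c / s x ^ n)"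
    using less_imp_neq[OF s_pos] by (intro continuous_intros cont) force+
  \<comment> \<open>The formula holds for all times before t1 and both sides are continuous, so it
    also holds at t1, where s is still positive.\<close>
  then have "continuous_on (closure {0..<t1}) (\<lambda>x. \<rho> x 0 - \<rho>c / s x ^ n)"
    by (rule continuous_on_subset) (use t1T in auto)
  then have "\<rho> t1 0 - \<rho>c / s t1 ^ n = 0"
    by (rule continuous_constant_on_closure) (use t1T before in auto)
  moreover have "\<rho>c / s t1 ^ n > 0" using \<rho>c s_pos[of t1] t1T by simp
  ultimately show False using t1(1) by (auto simp: S_def)
qed

text \<open>The finite horizon T lets the same formula serve scale factors that collapse and scale
  factors that live forever.\<close>

theorem solution_formula:
  fixes s p :: "real \<Rightarrow> real"
  assumes s: "\<And>t. t \<in> {0..T} \<Longrightarrow> (s has_real_derivative p t) (at t within {0..T})"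
    and p: "\<And>t. t \<in> {0..T} \<Longrightarrow>
      (p has_real_derivative - (lam * \<rho>c / n) * inverse (s t) ^ (n - 1)) (at t within {0..T})"
    and s_pos: "\<And>t. t \<in> {0..T} \<Longrightarrow> s t > 0" and init: "s 0 = 1" "p 0 = 0"
    and t: "t \<in> {0..T}"
  shows "r \<ge> 0 \<Longrightarrow> \<rho> t r = \<rho>c / s t ^ n"
    and "r \<ge> 0 \<Longrightarrow> v t r = r * p t / s t"
    and "r > 0 \<Longrightarrow> (\<Phi> t has_real_derivative \<rho>c * r / (n * s t ^ n)) (at r)"
proof -
  have pos: "\<rho> x 0 > 0" if "x \<in> {0..T}" for x
    by (rule center_positive[OF s p s_pos init that])
  have flow: "v t r = r * p t / s t" "mass n \<rho> t r = \<rho>c * (r / s t) ^ n / n" if "r > 0" for r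
    using flow_if_center_positive[OF s p s_pos init pos t that] by auto
  have t0: "t \<ge> 0" using t by simp
  show "r \<ge> 0 \<Longrightarrow> \<rho> t r = \<rho>c / s t ^ n"
    by (rule density_if_center_positive[OF s p s_pos init pos t])
  show "v t r = r * p t / s t" if "r \<ge> 0"
    using that flow(1)[of r] v_center_zero[OF t0 pos[OF t]] by (cases "r = 0") auto
  show "(\<Phi> t has_real_derivative \<rho>c * r / (n * s t ^ n)) (at r)" if r: "r > 0"
  proof -
    have "r ^ n = r * r ^ (n - 1)" using n by (cases n) auto
    then have "mass n \<rho> t r / r ^ (n - 1) = \<rho>c * r / (n * s t ^ n)"
      using flow(2)[OF r] r by (simp add: power_divide)
    with regular_center_derivs(1)[OF t0 pos[OF t] r] show ?thesis by simp
  qed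
qed

end

text \<open>For \<open>\<lambda> > 0\<close> the ball collapses to arbitrarily small radius before a fixed time, so the density at
  a fixed radius is unbounded.\<close>

lemma no_global_solution:
  assumes n: "n \<ge> 1" and lam: "lam > 0" and \<rho>c: "\<rho>c > 0"
  shows "\<not> has_global_solution n lam (\<lambda>_. \<rho>c) (\<lambda>_. 0)"
proof
  assume "has_global_solution n lam (\<lambda>_. \<rho>c) (\<lambda>_. 0)"
  then obtain \<rho> v \<Phi> where sol: "\<rho> \<in> C_curves 1 {0..} 0" "v \<in> C_curves 1 {0..} 1"
    "radial_EP n lam (\<lambda>_. \<rho>c) (\<lambda>_. 0) \<rho> v \<Phi>"
    unfolding has_global_solution_def by blast
  interpret static_start n lam \<rho>c \<rho> v \<Phi>
    by unfold_locales (use assms sol in auto)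
  define b where "b = lam * \<rho>c / n"
  have b: "b > 0" using assms by (simp add: b_def)
  have "continuous_on {0..sqrt (2 / b)} (\<lambda>t. \<rho> t 1)"
    by (rule continuous_on_subset[OF \<rho>_continuous_time]) auto
  from compact_imp_bounded[OF compact_continuous_image[OF this]]
  obtain M where M: "M > 0" "\<And>t. t \<in> {0..sqrt (2 / b)} \<Longrightarrow> \<bar>\<rho> t 1\<bar> \<le> M"
    unfolding bounded_pos by auto
  \<comment> \<open>Chosen so that \<rho>c / \<delta> \<ge> 2 M; as \<delta> < 1 and n \<ge> 1, also
    \<rho>c / \<delta>^n \<ge> 2 M. Fixing M before \<delta> is legitimate because the time bound
    sqrt (2 / b) is independent of \<delta>.\<close>
  define \<delta> where "\<delta> = min (1 / 2) (\<rho>c / (2 * M))"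
  have \<delta>: "0 < \<delta>" "\<delta> < 1" "\<delta> \<le> \<rho>c / (2 * M)" using M \<rho>c by (auto simp: \<delta>_def)
  obtain s p T where sp: "s 0 = 1" "p 0 = 0" "0 \<le> T" "T \<le> sqrt (2 / b)" "s T = \<delta>"
    "\<And>t. t \<in> {0..T} \<Longrightarrow> (s has_real_derivative p t) (at t within {0..T})"
    "\<And>t. t \<in> {0..T} \<Longrightarrow> (p has_real_derivative - b * inverse (s t) ^ (n - 1)) (at t within {0..T})"
    "\<And>t. t \<in> {0..T} \<Longrightarrow> s t \<ge> \<delta>"
    using collapsing_ode_exists[OF b \<delta>(1,2), of "n - 1"] by blast
  have "\<rho> T 1 = \<rho>c / s T ^ n"
  proof (rule solution_formula(1)[OF sp(6) sp(7)[unfolded b_def] _ sp(1,2)])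
    show "0 < s t" if "t \<in> {0..T}" for t using sp(8)[OF that] \<delta>(1) by simp
  qed (use sp(3) in auto)
  moreover have "\<delta> ^ n \<le> \<delta> ^ 1" using n \<delta> by (intro power_decreasing) auto
  then have "\<rho>c / \<delta> ^ n \<ge> \<rho>c / \<delta>" using \<delta>(1) \<rho>c by (intro divide_left_mono) auto
  moreover have "\<rho>c / \<delta> \<ge> 2 * M" using \<delta>(1,3) M(1) by (simp add: field_simps)
  ultimately have "\<rho> T 1 \<ge> 2 * M" using sp(5) by simp
  with M(1) M(2)[of T] sp(3,4) show False by simp
qed

section \<open>Smoothness in the sense of curves\<close>

lemma funpow_deriv_cmult:
  fixes p :: "nat \<Rightarrow> real \<Rightarrow> real"
  assumes "\<And>i r. (p i has_real_derivative p (Suc i) r) (at r)"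
  shows "(deriv ^^ i) (\<lambda>r. c * p 0 r) = (\<lambda>r. c * p i r)"
proof (induction i)
  case (Suc i)
  have "deriv (\<lambda>r. c * p i r) = (\<lambda>r. c * p (Suc i) r)"
    by (intro ext DERIV_imp_deriv DERIV_cmult assms)
  with Suc show ?case by simp
qed simp

context
  fixes p :: "nat \<Rightarrow> real \<Rightarrow> real"
  assumes p: "\<And>i r. (p i has_real_derivative p (Suc i) r) (at r)"
begin

lemma continuous_p: "continuous_on A (p i)"
  using p by (intro continuous_at_imp_continuous_on) (blast intro: DERIV_isCont)

lemma D_space_cmult: "(\<lambda>r. c * p 0 r) \<in> D_space s"
  unfolding D_space_def mem_Collect_eq funpow_deriv_cmult[of p, OF p]
  using DERIV_cmult[OF p] by (auto intro!: continuous_intros continuous_p simp: real_differentiable_def)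

text \<open>Every r-derivative of a separated function is the same scalar times some
  \<open>p i\<close>, which is bounded on compact intervals, so convergence in all the spaces
  reduces to convergence of the scalar.\<close>

lemma D_tendsto_cmult:
  assumes "(f \<longlongrightarrow> c) F" "\<And>x. g x = (\<lambda>r. f x * p 0 r)"
  shows "D_tendsto s g (\<lambda>r. c * p 0 r) F"
proof -
  have "uniform_limit {a..b} (\<lambda>x r. f x * p i r) (\<lambda>r. c * p i r) F" for i a b
  proof (rule bounded_bilinear.bounded_uniform_limit[OF bounded_bilinear_mult])
    show "uniform_limit {a..b} (\<lambda>x r. f x) (\<lambda>r. c) F"
      using assms(1) by (auto simp: uniform_limit_iff tendsto_iff elim: eventually_mono)
    show "bounded (p i ` {a..b})"
      by (intro compact_imp_bounded compact_continuous_image continuous_p compact_Icc)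
  qed (auto intro!: uniform_limit_const simp: image_constant_conv)
  then show ?thesis
    unfolding D_tendsto_def assms(2) funpow_deriv_cmult[of p, OF p] by (metis)
qed

text \<open>Induction on k requires the derivative of g to be as good as g itself, so the hypothesis
  concerns a class A closed under differentiation.\<close>

lemma C_curve_product:
  assumes closed: "\<And>g. g \<in> A \<Longrightarrow> \<exists>g'\<in>A. \<forall>t\<in>I. (g has_real_derivative g' t) (at t within I)"
    and "g \<in> A"
  shows "C_curve k s I (\<lambda>t r. g t * p 0 r)"
  using \<open>g \<in> A\<close>
proof (induction k arbitrary: g)
  case 0
  obtain g' where "\<And>t. t \<in> I \<Longrightarrow> (g has_real_derivative g' t) (at t within I)"
    using closed[OF 0] by blast
  then have "(g \<longlongrightarrow> g t) (at t within I)" if "t \<in> I" for t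
    using DERIV_continuous[of g "g' t" t I] that by (simp add: continuous_within)
  then show ?case by (auto intro!: D_space_cmult D_tendsto_cmult[where f = g])
next
  case (Suc k)
  obtain g' where g': "g' \<in> A" "\<And>t. t \<in> I \<Longrightarrow> (g has_real_derivative g' t) (at t within I)"
    using closed[OF Suc.prems] by blast
  have "D_tendsto s (\<lambda>\<tau> r. (g \<tau> * p 0 r - g t * p 0 r) / (\<tau> - t)) (\<lambda>r. g' t * p 0 r) (at t within I)" if "t \<in> I" for t
    by (rule D_tendsto_cmult[where f = "\<lambda>\<tau>. (g \<tau> - g t) / (\<tau> - t)"])
      (use g'(2)[OF that] in \<open>auto simp: has_field_derivative_iff left_diff_distrib diff_divide_distrib\<close>)
  with Suc.IH[OF g'(1)] show ?case by (auto intro!: D_space_cmult exI[of _ "\<lambda>t r. g' t * p 0 r"])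
qed

lemma C_curves_product:
  assumes "\<And>g. g \<in> A \<Longrightarrow> \<exists>g'\<in>A. \<forall>t\<in>I. (g has_real_derivative g' t) (at t within I)" "g \<in> A"
  shows "(\<lambda>t r. g t * p 0 r) \<in> C_curves k I s"
  unfolding C_curves_def using C_curve_product[OF assms] by simp

end

text \<open>The coefficients of the explicit solution are polynomials in \<open>1 / s\<close> and \<open>s'\<close>, an algebra that is
  closed under time derivatives; this yields derivatives of all orders at once.\<close>

inductive_set poly_closure :: "(real \<Rightarrow> real) set \<Rightarrow> (real \<Rightarrow> real) set" for B where
  base: "b \<in> B \<Longrightarrow> b \<in> poly_closure B"
| const: "(\<lambda>_. c) \<in> poly_closure B"
| add: "f \<in> poly_closure B \<Longrightarrow> g \<in> poly_closure B \<Longrightarrow> (\<lambda>t. f t + g t) \<in> poly_closure B"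
| mult: "f \<in> poly_closure B \<Longrightarrow> g \<in> poly_closure B \<Longrightarrow> (\<lambda>t. f t * g t) \<in> poly_closure B"

lemma poly_closure_power: "f \<in> poly_closure B \<Longrightarrow> (\<lambda>t. f t ^ k) \<in> poly_closure B"
  by (induction k) (auto intro: poly_closure.intros)

lemma poly_closure_deriv:
  assumes base: "\<And>b. b \<in> B \<Longrightarrow> \<exists>b'\<in>poly_closure B. \<forall>t\<in>I. (b has_real_derivative b' t) (at t within I)"
    and "f \<in> poly_closure B"
  shows "\<exists>f'\<in>poly_closure B. \<forall>t\<in>I. (f has_real_derivative f' t) (at t within I)"
  using assms(2)
proof induction
  case (const c)
  show ?case by (rule bexI[of _ "\<lambda>_. 0"]) (auto intro: poly_closure.const)
next
  case (add f g)
  then obtain f' g' where *: "f' \<in> poly_closure B" "g' \<in> poly_closure B"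
    "\<And>t. t \<in> I \<Longrightarrow> (f has_real_derivative f' t) (at t within I)"
    "\<And>t. t \<in> I \<Longrightarrow> (g has_real_derivative g' t) (at t within I)" by blast
  show ?case
    by (rule bexI[of _ "\<lambda>t. f' t + g' t"]) (use * in \<open>auto intro!: DERIV_add poly_closure.add\<close>)
next
  case (mult f g)
  then obtain f' g' where *: "f' \<in> poly_closure B" "g' \<in> poly_closure B"
    "\<And>t. t \<in> I \<Longrightarrow> (f has_real_derivative f' t) (at t within I)"
    "\<And>t. t \<in> I \<Longrightarrow> (g has_real_derivative g' t) (at t within I)" by blast
  show ?case
    by (rule bexI[of _ "\<lambda>t. f' t * g t + g' t * f t"])
      (use * mult.hyps in \<open>auto intro!: DERIV_mult poly_closure.add poly_closure.mult\<close>)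
qed (rule base)

text \<open>Dividing by factorials makes differentiation a pure index shift. The conditional is
  essential: for i > m truncated subtraction would give the constant 1 instead of 0.\<close>

lemma monomial_derivs:
  fixes r :: real
  shows "((\<lambda>r. (if i \<le> m then r ^ (m - i) / fact (m - i) else 0)) has_real_derivative
    (if Suc i \<le> m then r ^ (m - Suc i) / fact (m - Suc i) else 0)) (at r)"
proof (cases "Suc i \<le> m")
  case True
  then obtain j where j: "m - i = Suc j" "m - Suc i = j" "i \<le> m"
    by (metis Suc_diff_Suc Suc_le_lessD less_imp_le)
  have "((\<lambda>r. r ^ Suc j / fact (Suc j)) has_real_derivative r ^ j / fact j) (at r)"
    by (rule DERIV_cong[OF DERIV_cdivide[OF DERIV_power_Suc[OF DERIV_ident]]])
      (simp add: field_simps del: of_nat_Suc flip: of_nat_Suc)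
  then show ?thesis using True j by simp
next
  case False
  then show ?thesis by (cases "i \<le> m") auto
qed

lemma C_curves_monomial:
  assumes "\<And>g. g \<in> A \<Longrightarrow> \<exists>g'\<in>A. \<forall>t\<in>I. (g has_real_derivative g' t) (at t within I)" "g \<in> A"
  shows "(\<lambda>t r. g t * (r ^ m / fact m)) \<in> C_curves k I s"
  using C_curves_product[of "\<lambda>i r. if i \<le> m then r ^ (m - i) / fact (m - i) else 0" A I g k s]
    monomial_derivs assms by simp

section \<open>Distributional derivatives of classical functions\<close>

lemma integral_lborel_translate:
  fixes u :: "'a::euclidean_space \<Rightarrow> real"
  assumes "u \<in> borel_measurable borel"
  shows "(LINT z|lborel. u (c + z)) = (LINT z|lborel. u z)"
  using integral_distr[of "(+) c" lborel borel u] assms by (simp add: lborel_distr_plus)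

lemma integrable_lborel_translate:
  fixes u :: "'a::euclidean_space \<Rightarrow> real"
  assumes "integrable lborel u"
  shows "integrable lborel (\<lambda>z. u (c + z))"
  by (rule integrable_distr[of _ _ borel]) (use assms in \<open>auto simp: lborel_distr_plus\<close>)

lemma integrable_continuous_compact_support:
  fixes u :: "'a::euclidean_space \<Rightarrow> real"
  assumes "compact K" "continuous_on K u" "\<And>z. z \<notin> K \<Longrightarrow> u z = 0"
  shows "integrable lborel u"
proof -
  have "indicator K z *\<^sub>R u z = u z" for z using assms(3)[of z] by (cases "z \<in> K") auto
  then have "(\<lambda>z. indicator K z *\<^sub>R u z) = u" by (rule ext)
  with borel_integrable_compact[OF assms(1,2)] show ?thesis by (rule subst[where P = "integrable lborel", rotated])
qed

text \<open>The integral of \<open>u\<close> is translation invariant, so the difference quotients in direction \<open>e\<close>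
  all have integral zero; pass to the limit by dominated convergence.\<close>

lemma integral_directional_derivative_zero:
  fixes u g :: "'a::euclidean_space \<Rightarrow> real"
  assumes deriv: "\<And>z. ((\<lambda>h. u (z + h *\<^sub>R e)) has_real_derivative g z) (at 0)"
    and cont: "continuous_on UNIV u" "continuous_on UNIV g"
    and K: "compact K" "\<And>z. z \<notin> K \<Longrightarrow> u z = 0" "\<And>z. z \<notin> K \<Longrightarrow> g z = 0"
  shows "(LINT z|lborel. g z) = 0"
proof -
  obtain M where "\<And>x. x \<in> K \<Longrightarrow> norm x \<le> M"
    using compact_imp_bounded[OF K(1)] unfolding bounded_iff by auto
  then have M: "K \<subseteq> cball 0 M" by auto
  have "bounded (g ` K)"
    by (intro compact_imp_bounded compact_continuous_image continuous_on_subset[OF cont(2)] K) auto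
  then obtain B where B: "B > 0" "\<And>z. z \<in> K \<Longrightarrow> \<bar>g z\<bar> \<le> B"
    unfolding bounded_pos by auto
  have gB: "\<bar>g z\<bar> \<le> B" for z using B K(3)[of z] by (cases "z \<in> K") auto
  define \<eta> where "\<eta> = (\<lambda>k::nat. inverse (real (Suc k)))"
  have \<eta>: "\<eta> k > 0" "\<eta> k \<le> 1" for k by (auto simp: \<eta>_def inverse_le_1_iff)
  define q where "q = (\<lambda>k z. (u (\<eta> k *\<^sub>R e + z) - u z) / \<eta> k)"
  \<comment> \<open>The majorant: outside this ball neither z nor its translate by at most
    \<open>norm e\<close> meets K, so the quotient vanishes; inside, the mean value theorem bounds
    it by B.\<close>
  define w where "w = (\<lambda>z. B * indicator (cball (0::'a) (M + norm e)) z)"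
  have bm: "u \<in> borel_measurable borel" "g \<in> borel_measurable borel"
    using cont by (auto intro: borel_measurable_continuous_onI)
  have int_u: "integrable lborel u"
    by (rule integrable_continuous_compact_support[OF K(1)])
      (use cont(1) K(2) in \<open>auto intro: continuous_on_subset\<close>)
  have q_bound: "\<bar>q k z\<bar> \<le> w z" for k z
  proof (cases "z \<in> cball 0 (M + norm e)")
    case True
    have D: "((\<lambda>h. u (z + h *\<^sub>R e)) has_real_derivative g (z + x *\<^sub>R e)) (at x)" for x
      using deriv[of "z + x *\<^sub>R e"] DERIV_shift[of "\<lambda>h. u (z + h *\<^sub>R e)" "g (z + x *\<^sub>R e)" 0 x]
      by (simp add: scaleR_left_distrib add_ac)
    obtain x where "u (z + \<eta> k *\<^sub>R e) - u (z + 0 *\<^sub>R e) = (\<eta> k - 0) * g (z + x *\<^sub>R e)"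
      using MVT2[of 0 "\<eta> k" "\<lambda>h. u (z + h *\<^sub>R e)" "\<lambda>x. g (z + x *\<^sub>R e)"] D \<eta>(1)[of k] by blast
    then have "q k z = g (z + x *\<^sub>R e)" using \<eta>(1)[of k] by (simp add: q_def add.commute)
    then show ?thesis using gB True by (simp add: w_def)
  next
    case False
    have "norm (\<eta> k *\<^sub>R e) \<le> norm e" using \<eta>[of k] by (simp add: mult_left_le_one_le)
    moreover have "norm z \<le> norm (\<eta> k *\<^sub>R e + z) + norm (\<eta> k *\<^sub>R e)"
      using norm_triangle_ineq4[of "\<eta> k *\<^sub>R e + z" "\<eta> k *\<^sub>R e"] by simp
    moreover have "norm z > M + norm e" using False by simp
    moreover have "norm e \<ge> 0" by simp
    ultimately have "norm (\<eta> k *\<^sub>R e + z) > M" "norm z > M" by linarith+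
    then have "\<eta> k *\<^sub>R e + z \<notin> cball 0 M" "z \<notin> cball 0 M" by auto
    then have "u (\<eta> k *\<^sub>R e + z) = 0" "u z = 0" using M K(2) by blast+
    then show ?thesis using B by (simp add: q_def w_def)
  qed
  have lim: "(\<lambda>k. LINT z|lborel. q k z) \<longlonglongrightarrow> (LINT z|lborel. g z)"
  proof (rule integral_dominated_convergence[where w = w])
    show "integrable lborel w"
      unfolding w_def using emeasure_bounded_finite[OF bounded_cball]
      by (intro integrable_mult_right integrable_real_indicator) simp_all
    show "AE z in lborel. (\<lambda>k. q k z) \<longlonglongrightarrow> g z"
    proof (rule AE_I2)
      fix z
      have "((\<lambda>h. (u (z + h *\<^sub>R e) - u z) / h) \<longlongrightarrow> g z) (at 0)"
        using deriv[of z] by (simp add: has_field_derivative_iff)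
      moreover have "filterlim \<eta> (at 0) sequentially"
        unfolding filterlim_at \<eta>_def using LIMSEQ_inverse_real_of_nat by (auto intro!: always_eventually)
      ultimately have "(\<lambda>k. (u (z + \<eta> k *\<^sub>R e) - u z) / \<eta> k) \<longlonglongrightarrow> g z"
        by (rule filterlim_compose)
      then show "(\<lambda>k. q k z) \<longlonglongrightarrow> g z" by (simp add: q_def add.commute)
    qed
  qed (use bm q_bound in \<open>auto simp: q_def[abs_def]\<close>)
  have zero: "(LINT z|lborel. q k z) = 0" for k
    unfolding q_def using integrable_lborel_translate[OF int_u, of "\<eta> k *\<^sub>R e"] int_u
    by (simp add: integral_lborel_translate[OF bm(1)])
  show ?thesis
    using LIMSEQ_unique[OF lim[unfolded zero] tendsto_const] .
qed

section \<open>Test functions and classical distributional derivatives\<close>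

lemma open_spacetime: "open (spacetime :: (real \<times> (real ^ 'n::finite)) set)"
  unfolding spacetime_def by (intro open_Times) auto

lemma test_function_Ck: "test_function \<phi> \<Longrightarrow> Ck_on_UNIV k \<phi>"
  unfolding test_function_def by (elim conjE) (erule spec)

lemma test_function_differentiable:
  assumes "test_function \<phi>"
  shows "\<phi> differentiable (at z)"
  using test_function_Ck[OF assms, of "Suc 0"] unfolding Ck_on_UNIV.simps by (elim conjE) (erule spec)

lemma test_function_continuous:
  assumes "test_function \<phi>"
  shows "continuous_on UNIV \<phi>"
  using test_function_Ck[OF assms, of 0] unfolding Ck_on_UNIV.simps .

lemma test_function_support:
  assumes "test_function \<phi>"
  obtains K where "compact K" "K \<subseteq> spacetime" "\<And>z. z \<notin> K \<Longrightarrow> \<phi> z = 0"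
proof -
  obtain K where "compact K" "K \<subseteq> spacetime" "\<forall>z. z \<notin> K \<longrightarrow> \<phi> z = 0"
    using assms unfolding test_function_def by (elim conjE exE)
  with that show thesis by blast
qed

lemma frechet_derivative_zero_outside:
  fixes \<phi> :: "'a::euclidean_space \<Rightarrow> real"
  assumes "compact K" "\<And>z. z \<notin> K \<Longrightarrow> \<phi> z = 0" "z \<notin> K"
  shows "frechet_derivative \<phi> (at z) = (\<lambda>_. 0)"
proof -
  have "((\<lambda>_. 0) has_derivative (\<lambda>_. 0)) (at z)" by simp
  then have "(\<phi> has_derivative (\<lambda>_. 0)) (at z)"
    by (rule has_derivative_transform_within_open[where s = "- K"])
      (use assms compact_imp_closed[OF assms(1)] in auto)
  then show ?thesis by (simp add: frechet_derivative_at[symmetric])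
qed

text \<open>In \<open>D_x i (D_x i T)\<close> the outer derivative passes a derivative of the test
  function to the inner one, so the Laplacian requires this closure property.\<close>

lemma test_function_deriv:
  fixes \<phi> :: "real \<times> (real ^ 'n::finite) \<Rightarrow> real"
  assumes \<phi>: "test_function \<phi>" and e: "e \<in> Basis"
  shows "test_function (\<lambda>z. frechet_derivative \<phi> (at z) e)"
proof -
  obtain K where K: "compact K" "K \<subseteq> spacetime" "\<And>z. z \<notin> K \<Longrightarrow> \<phi> z = 0"
    using test_function_support[OF \<phi>] by metis
  have "frechet_derivative \<phi> (at z) = (\<lambda>_. 0)" if "z \<notin> K" for z
    by (rule frechet_derivative_zero_outside[OF K(1) K(3) that])
  moreover have "Ck_on_UNIV k (\<lambda>z. frechet_derivative \<phi> (at z) e)" for k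
    using test_function_Ck[OF \<phi>, of "Suc k"] e by simp
  ultimately show ?thesis
    unfolding test_function_def using K(1,2) by (intro conjI allI exI[of _ K]) auto
qed

lemma integrable_test_function_mult:
  fixes f \<phi> :: "real \<times> (real ^ 'n::finite) \<Rightarrow> real"
  assumes "test_function \<phi>" "continuous_on spacetime f"
  shows "integrable lborel (\<lambda>z. f z * \<phi> z)"
proof -
  obtain K where K: "compact K" "K \<subseteq> spacetime" "\<And>z. z \<notin> K \<Longrightarrow> \<phi> z = 0"
    using test_function_support[OF assms(1)] by metis
  have "continuous_on K (\<lambda>z. f z * \<phi> z)"
    using continuous_on_subset[OF assms(2) K(2)] continuous_on_subset[OF test_function_continuous[OF assms(1)]]
    by (intro continuous_on_mult) auto
  then show ?thesis using K by (intro integrable_continuous_compact_support[of K]) auto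
qed

lemma loc_integrable_continuous: "continuous_on spacetime f \<Longrightarrow> loc_integrable f"
  unfolding loc_integrable_def set_integrable_def
  by (intro allI impI borel_integrable_compact) (auto elim: continuous_on_subset)

lemma distr_add:
  assumes "test_function \<phi>" "continuous_on spacetime f" "continuous_on spacetime g"
  shows "distr f \<phi> + distr g \<phi> = distr (\<lambda>z. f z + g z) \<phi>"
  using assms unfolding distr_def by (simp add: integrable_test_function_mult distrib_right)

lemma distr_cmult: "distr (\<lambda>z. c * f z) \<phi> = c * distr f \<phi>"
  unfolding distr_def by (simp add: mult.assoc)

text \<open>Coefficients of the explicit solution satisfy their identities only for t \<ge> 0; the
  support of the test function hides all other times.\<close>

lemma distr_cong:
  assumes "test_function \<phi>" "\<And>z. z \<in> spacetime \<Longrightarrow> f z = g z"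
  shows "distr f \<phi> = distr g \<phi>"
proof -
  obtain K where "K \<subseteq> spacetime" "\<And>z. z \<notin> K \<Longrightarrow> \<phi> z = 0"
    using test_function_support[OF assms(1)] by metis
  then have "\<phi> z = 0" if "z \<notin> spacetime" for z
    using that by blast
  then have *: "f z * \<phi> z = g z * \<phi> z" for z
    using assms(2)[of z] by (cases "z \<in> spacetime") simp_all
  show ?thesis unfolding distr_def * ..
qed

text \<open>Integration by parts: the directional derivative of f \<phi> has integral zero. As f is
  regular only on \<open>spacetime\<close>, regularity of f \<phi> is glued from the open sets
  \<open>spacetime\<close> and \<open>- K\<close>, on the latter of which it vanishes.\<close>

lemma distr_deriv_classical:
  fixes f :: "real \<times> (real ^ 'n::finite) \<Rightarrow> real"
  assumes \<phi>: "test_function \<phi>" and e: "e \<in> Basis"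
    and f: "\<And>z. z \<in> spacetime \<Longrightarrow> (f has_derivative f' z) (at z)"
    and cont: "continuous_on spacetime (\<lambda>z. f' z e)"
  shows "distr_deriv e (distr f) \<phi> = distr (\<lambda>z. f' z e) \<phi>"
proof -
  obtain K where K: "compact K" "K \<subseteq> spacetime" "\<And>z. z \<notin> K \<Longrightarrow> \<phi> z = 0"
    using test_function_support[OF \<phi>] by metis
  let ?d\<phi> = "\<lambda>z. frechet_derivative \<phi> (at z) e"
  have oK: "open (- K)" using compact_imp_closed[OF K(1)] by auto
  have d\<phi>: "(\<phi> has_derivative frechet_derivative \<phi> (at z)) (at z)" for z
    using test_function_differentiable[OF \<phi>] by (simp add: frechet_derivative_works)
  have test': "test_function ?d\<phi>" by (rule test_function_deriv[OF \<phi> e])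
  have d\<phi>0: "?d\<phi> z = 0" if "z \<notin> K" for z
    by (simp add: frechet_derivative_zero_outside[OF K(1) K(3) that])
  have cont_f: "continuous_on spacetime f"
    using f by (intro continuous_at_imp_continuous_on) (blast intro: has_derivative_continuous)
  define u where "u = (\<lambda>z. f z * \<phi> z)"
  define g where "g = (\<lambda>z. f' z e * \<phi> z + f z * ?d\<phi> z)"
  have cover: "UNIV = - K \<union> spacetime" using K(2) by auto
  have zeroK: "u z = 0" "g z = 0" if "z \<notin> K" for z
    using that K(3) d\<phi>0 by (auto simp: u_def g_def)
  have glue: "continuous_on UNIV h" if "continuous_on spacetime h" "\<And>z. z \<notin> K \<Longrightarrow> h z = 0"
    for h :: "real \<times> (real ^ 'n) \<Rightarrow> real"
  proof -
    have "continuous_on (- K) h"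
      by (rule continuous_on_eq[of _ "\<lambda>_. 0"]) (use that(2) in auto)
    then show ?thesis
      unfolding cover using that(1) by (intro continuous_on_open_Un oK open_spacetime)
  qed
  have "(LINT z|lborel. g z) = 0"
  proof (rule integral_directional_derivative_zero[where u = u and K = K and e = e])
    show "((\<lambda>h. u (z + h *\<^sub>R e)) has_real_derivative g z) (at 0)" for z
    proof -
      have "(u has_derivative (\<lambda>d. f z * frechet_derivative \<phi> (at z) d + f' z d * \<phi> z)) (at z)"
        if "z \<in> spacetime"
        unfolding u_def by (intro has_derivative_mult f that d\<phi>)
      moreover have "(u has_derivative (\<lambda>d. 0)) (at z)" if "z \<notin> K"
        by (rule has_derivative_transform_within_open[OF has_derivative_const[of 0] oK])
          (use that zeroK in auto)
      ultimately obtain u' where u': "(u has_derivative u') (at z)" "u' e = g z"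
        using zeroK(2)[of z] K(2) by (cases "z \<in> K") (auto simp: g_def)
      have "((\<lambda>h. z + h *\<^sub>R e) has_derivative (\<lambda>h. h *\<^sub>R e)) (at 0)"
        by (auto intro!: derivative_eq_intros)
      then have "((\<lambda>h. u (z + h *\<^sub>R e)) has_derivative (\<lambda>h. u' (h *\<^sub>R e))) (at 0)"
        by (rule has_derivative_compose) (use u' in simp)
      then show ?thesis
        using linear_scale[OF has_derivative_linear[OF u'(1)]] u'(2)
        by (simp add: has_field_derivative_def mult_commute_abs)
    qed
    show "continuous_on UNIV u"
      using cont_f zeroK(1) test_function_continuous[OF \<phi>] unfolding u_def
      by (intro glue continuous_on_mult) (auto elim: continuous_on_subset)
    show "continuous_on UNIV g"
    proof (rule glue)
      show "continuous_on spacetime g"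
        unfolding g_def using cont cont_f test_function_continuous[OF \<phi>] test_function_continuous[OF test']
        by (intro continuous_on_add continuous_on_mult) (auto elim: continuous_on_subset)
    qed (rule zeroK)
  qed (use K zeroK in auto)
  moreover have "(LINT z|lborel. g z) = distr (\<lambda>z. f' z e) \<phi> + distr f ?d\<phi>"
    unfolding g_def distr_def
    by (intro Bochner_Integration.integral_add integrable_test_function_mult \<phi> test' cont cont_f)
  ultimately show ?thesis by (simp add: distr_deriv_def)
qed

section \<open>Separated functions of time and space, and the multi-dimensional equations\<close>

lemma has_derivative_separated:
  fixes \<pi> :: "real ^ 'n::finite \<Rightarrow> real" and z :: "real \<times> (real ^ 'n)"
  assumes k: "(k has_real_derivative k') (at (fst z))"
    and \<pi>: "(\<pi> has_derivative \<pi>') (at (snd z))"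
  shows "((\<lambda>z. k (fst z) * \<pi> (snd z)) has_derivative
    (\<lambda>d. k' * fst d * \<pi> (snd z) + k (fst z) * \<pi>' (snd d))) (at z)"
proof -
  have "((\<lambda>z. k (fst z)) has_derivative (\<lambda>d. fst d * k')) (at z)"
    by (rule DERIV_compose_FDERIV[where g = fst, OF k]) (intro has_derivative_fst has_derivative_ident)
  moreover have "((\<lambda>z. \<pi> (snd z)) has_derivative (\<lambda>d. \<pi>' (snd d))) (at z)"
    by (rule has_derivative_compose[where f = snd and f' = snd and g = \<pi>, OF _ \<pi>])
      (intro has_derivative_snd has_derivative_ident)
  ultimately have "((\<lambda>z. k (fst z) * \<pi> (snd z)) has_derivative
      (\<lambda>d. k (fst z) * \<pi>' (snd d) + fst d * k' * \<pi> (snd z))) (at z)"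
    by (rule has_derivative_mult)
  then show ?thesis by (simp add: algebra_simps)
qed

lemma continuous_separated:
  assumes "continuous_on {0<..} k" "continuous_on UNIV \<pi>"
  shows "continuous_on spacetime (\<lambda>z. k (fst z) * (\<pi> (snd z) :: real))"
  by (intro continuous_on_mult continuous_on_compose2[OF assms(1)] continuous_on_compose2[OF assms(2)]
      continuous_intros) (auto simp: spacetime_def)

context
  fixes \<phi> :: "real \<times> (real ^ 'n::finite) \<Rightarrow> real" and k k' :: "real \<Rightarrow> real"
  assumes \<phi>: "test_function \<phi>"
    and k: "\<And>t. t > 0 \<Longrightarrow> (k has_real_derivative k' t) (at t)"
begin

lemma continuous_k: "continuous_on {0<..} k"
  by (rule DERIV_continuous_on) (use k in \<open>auto intro: has_field_derivative_at_within\<close>)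

lemma D_t_separated:
  assumes k': "continuous_on {0<..} k'"
    and \<pi>: "\<And>x. (\<pi> has_derivative \<pi>' x) (at x)"
  shows "D_t (distr (\<lambda>z. k (fst z) * \<pi> (snd z))) \<phi> = distr (\<lambda>z. k' (fst z) * \<pi> (snd z)) \<phi>"
proof -
  have c\<pi>: "continuous_on UNIV \<pi>"
    using \<pi> by (intro continuous_at_imp_continuous_on) (blast intro: has_derivative_continuous)
  have "D_t (distr (\<lambda>z. k (fst z) * \<pi> (snd z))) \<phi> = distr (\<lambda>z. k' (fst z) * fst (1::real, 0 :: real ^ 'n)
      * \<pi> (snd z) + k (fst z) * \<pi>' (snd z) (snd (1::real, 0 :: real ^ 'n))) \<phi>"
    using linear_0[OF has_derivative_linear[OF \<pi>]]
    by (intro distr_deriv_classical[OF \<phi>] has_derivative_separated[OF k \<pi>])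
      (auto simp: spacetime_def Basis_prod_def intro!: continuous_separated[OF k' c\<pi>, unfolded spacetime_def])
  then show ?thesis using linear_0[OF has_derivative_linear[OF \<pi>]] by simp
qed

lemma D_x_separated:
  assumes \<pi>: "\<And>x. (\<pi> has_derivative \<pi>' x) (at x)" and cont: "continuous_on UNIV (\<lambda>x. \<pi>' x (axis i 1))"
  shows "D_x i (distr (\<lambda>z. k (fst z) * \<pi> (snd z))) \<phi> = distr (\<lambda>z. k (fst z) * \<pi>' (snd z) (axis i 1)) \<phi>"
proof -
  have "D_x i (distr (\<lambda>z. k (fst z) * \<pi> (snd z))) \<phi> = distr (\<lambda>z. k' (fst z) * fst (0::real, axis i 1 :: real ^ 'n)
      * \<pi> (snd z) + k (fst z) * \<pi>' (snd z) (snd (0::real, axis i 1 :: real ^ 'n))) \<phi>"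
    by (intro distr_deriv_classical[OF \<phi>] has_derivative_separated[OF k \<pi>])
      (auto simp: spacetime_def Basis_prod_def axis_in_Basis_iff
        intro!: continuous_separated[OF continuous_k cont, unfolded spacetime_def])
  then show ?thesis by simp
qed

end

lemma has_derivative_component: "((\<lambda>x. x $ i) has_derivative (\<lambda>d. d $ i)) (at (x :: real ^ 'n::finite))"
  by (rule bounded_linear.has_derivative[OF bounded_linear_vec_nth has_derivative_ident])

text \<open>The field h x has Jacobian h times the identity, so its divergence is n h and its
  convection term h^2 x; q |x|^2 has gradient 2 q x and Laplacian 2 n q. All fields are smooth in x
  even at the origin, so the classical identities pass directly to distributions.\<close>

lemma EP_distributional_linear_flow:
  fixes R h q h' :: "real \<Rightarrow> real"
  assumes R: "\<And>t. t > 0 \<Longrightarrow> (R has_real_derivative - (CARD('n) * (R t * h t))) (at t)"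
    and h: "\<And>t. t > 0 \<Longrightarrow> (h has_real_derivative h' t) (at t)"
    and q: "\<And>t. t > 0 \<Longrightarrow> (q has_real_derivative q' t) (at t)"
    and cont: "continuous_on {0<..} h'"
    and mom: "\<And>t. t > 0 \<Longrightarrow> h' t + (h t)\<^sup>2 = - lam * (2 * q t)"
    and poisson: "\<And>t. t > 0 \<Longrightarrow> R t = CARD('n) * (2 * q t)"
  shows "EP_distributional lam (\<lambda>z :: real \<times> (real ^ 'n::finite). R (fst z))
    (\<lambda>z. h (fst z) *\<^sub>R snd z) (\<lambda>z. q (fst z) * (norm (snd z))\<^sup>2)"
proof -
  have cR: "continuous_on {0<..} R" by (rule DERIV_continuous_on) (use R in \<open>auto intro: has_field_derivative_at_within\<close>)
  have ch: "continuous_on {0<..} h" by (rule DERIV_continuous_on) (use h in \<open>auto intro: has_field_derivative_at_within\<close>)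
  have cq: "continuous_on {0<..} q" by (rule DERIV_continuous_on) (use q in \<open>auto intro: has_field_derivative_at_within\<close>)
  have Rh: "((\<lambda>t. R t * h t) has_real_derivative R t * h' t + - (CARD('n) * (R t * h t)) * h t) (at t)" if "t > 0" for t
    by (rule DERIV_cong[OF DERIV_mult[OF R[OF that] h[OF that]]]) (simp add: algebra_simps)
  have q2: "((\<lambda>t. 2 * q t) has_real_derivative 2 * q' t) (at t)" if "t > 0" for t
    by (intro DERIV_cmult q that)
  have norm2: "((\<lambda>x :: real ^ 'n. (norm x)\<^sup>2) has_derivative (\<lambda>d. 2 * (x \<bullet> d))) (at x)" for x
    unfolding power2_norm_eq_inner by (auto intro!: derivative_eq_intros simp: inner_commute)
  have c_norm2: "continuous_on UNIV (\<lambda>x :: real ^ 'n. (norm x)\<^sup>2)"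
    by (intro continuous_intros)
  have c_comp: "continuous_on UNIV (\<lambda>x :: real ^ 'n. x $ i)" for i
    by (intro continuous_intros)
  note sep = continuous_separated
  have cR0: "continuous_on spacetime (\<lambda>z :: real \<times> (real ^ 'n). R (fst z))"
    using sep[OF cR continuous_on_const[of _ 1]] by simp
  have ch0: "continuous_on spacetime (\<lambda>z :: real \<times> (real ^ 'n). h (fst z))"
    using sep[OF ch continuous_on_const[of _ 1]] by simp
  have cv: "continuous_on spacetime (\<lambda>z :: real \<times> (real ^ 'n). h (fst z) * snd z $ i)" for i
    by (rule sep[OF ch c_comp])
  have cont_eq: "D_t (distr (\<lambda>z. R (fst z))) \<phi> + (\<Sum>i\<in>UNIV. D_x i (distr (\<lambda>z. R (fst z) * (h (fst z) *\<^sub>R snd z) $ i)) \<phi>) = 0"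
    if \<phi>: "test_function \<phi>" for \<phi> :: "real \<times> (real ^ 'n) \<Rightarrow> real"
  proof -
    have "D_t (distr (\<lambda>z. R (fst z) * 1)) \<phi> = distr (\<lambda>z. - (CARD('n) * (R (fst z) * h (fst z))) * 1) \<phi>"
      by (rule D_t_separated[OF \<phi> R, where \<pi> = "\<lambda>_. 1" and \<pi>' = "\<lambda>_ _. 0"])
        (auto intro!: continuous_intros cR ch)
    then have "D_t (distr (\<lambda>z. R (fst z))) \<phi> = - CARD('n) * distr (\<lambda>z. R (fst z) * h (fst z)) \<phi>"
      by (simp flip: distr_cmult)
    moreover have "D_x i (distr (\<lambda>z. R (fst z) * (h (fst z) *\<^sub>R snd z) $ i)) \<phi> = distr (\<lambda>z. R (fst z) * h (fst z)) \<phi>" for i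
      using D_x_separated[OF \<phi> Rh has_derivative_component, of i i] by (simp add: mult.assoc)
    ultimately show ?thesis by simp
  qed
  \<comment> \<open>h times the identity matrix, in the form that \<open>D_x_separated\<close>
    produces from the linear map \<open>\<lambda>d. d $ i\<close> applied to
    \<open>axis j 1\<close>.\<close>
  define G where "G = (\<lambda>(i::'n) (j::'n) (z :: real \<times> (real ^ 'n)). h (fst z) * (axis j 1 :: real ^ 'n) $ i)"
  have G_sum: "(\<Sum>j\<in>UNIV. (h (fst z) *\<^sub>R snd z) $ j * G i j z) = (h (fst z))\<^sup>2 * snd z $ i" for i z
  proof -
    have "(h (fst z) *\<^sub>R snd z) $ j * G i j z = (if j = i then (h (fst z))\<^sup>2 * snd z $ i else 0)" for j
      by (simp add: G_def axis_def power2_eq_square)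
    then show ?thesis by simp
  qed
  have cG: "continuous_on spacetime (G i j)" for i j
    unfolding G_def by (intro continuous_on_mult ch0 continuous_on_const)
  have G: "D_x j (distr (\<lambda>z. (h (fst z) *\<^sub>R snd z) $ i)) \<phi> = distr (G i j) \<phi>"
    if \<phi>: "test_function \<phi>" for \<phi> i j
    using D_x_separated[OF \<phi> h has_derivative_component, of j i] by (simp add: G_def)
  have P: "D_x i (distr (\<lambda>z. q (fst z) * (norm (snd z))\<^sup>2)) \<phi> = distr (\<lambda>z. (2 * q (fst z)) * snd z $ i) \<phi>"
    if \<phi>: "test_function \<phi>" for \<phi> :: "real \<times> (real ^ 'n) \<Rightarrow> real" and i
  proof -
    have eq: "2 * (x \<bullet> axis i 1) = 2 * x $ i" for x :: "real ^ 'n" by (simp add: inner_axis)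
    have "continuous_on UNIV (\<lambda>x :: real ^ 'n. 2 * x $ i)" by (intro continuous_intros)
    then show ?thesis
      using D_x_separated[OF \<phi> q norm2, of i] unfolding eq by (simp add: mult.assoc mult.left_commute)
  qed
  have mom_eq: "D_t (distr (\<lambda>z. (h (fst z) *\<^sub>R snd z) $ i)) \<phi> + distr (\<lambda>z. \<Sum>j\<in>UNIV. (h (fst z) *\<^sub>R snd z) $ j * G i j z) \<phi>
      = - lam * D_x i (distr (\<lambda>z. q (fst z) * (norm (snd z))\<^sup>2)) \<phi>"
    if \<phi>: "test_function \<phi>" for \<phi> i
  proof -
    have "D_t (distr (\<lambda>z. (h (fst z) *\<^sub>R snd z) $ i)) \<phi> = distr (\<lambda>z. h' (fst z) * snd z $ i) \<phi>"
      using D_t_separated[OF \<phi> h cont has_derivative_component, of i] by simp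
    moreover have "distr (\<lambda>z. h' (fst z) * snd z $ i) \<phi> + distr (\<lambda>z. (h (fst z))\<^sup>2 * snd z $ i) \<phi>
        = distr (\<lambda>z. h' (fst z) * snd z $ i + (h (fst z))\<^sup>2 * snd z $ i) \<phi>"
      by (intro distr_add \<phi> sep[OF cont c_comp] sep[of "\<lambda>t. (h t)\<^sup>2", OF _ c_comp] continuous_intros ch)
    also have "\<dots> = distr (\<lambda>z. - lam * ((2 * q (fst z)) * snd z $ i)) \<phi>"
    proof (rule distr_cong[OF \<phi>])
      fix z :: "real \<times> (real ^ 'n)" assume "z \<in> spacetime"
      then show "h' (fst z) * snd z $ i + (h (fst z))\<^sup>2 * snd z $ i = - lam * ((2 * q (fst z)) * snd z $ i)"
        using mom[of "fst z"] by (auto simp: spacetime_def mult.assoc simp flip: distrib_right)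
    qed
    ultimately show ?thesis by (simp only: G_sum P[OF \<phi>] distr_cmult)
  qed
  have poisson_eq: "(\<Sum>i\<in>UNIV. D_x i (D_x i (distr (\<lambda>z. q (fst z) * (norm (snd z))\<^sup>2))) \<phi>) = distr (\<lambda>z. R (fst z)) \<phi>"
    if \<phi>: "test_function \<phi>" for \<phi> :: "real \<times> (real ^ 'n) \<Rightarrow> real"
  proof -
    have "D_x i (D_x i (distr (\<lambda>z. q (fst z) * (norm (snd z))\<^sup>2))) \<phi> = distr (\<lambda>z. 2 * q (fst z)) \<phi>" for i
    proof -
      have "(0, axis i 1) \<in> (Basis :: (real \<times> (real ^ 'n)) set)" by (auto simp: Basis_prod_def axis_in_Basis_iff)
      then have t: "test_function (\<lambda>z. frechet_derivative \<phi> (at z) (0, axis i 1))" by (rule test_function_deriv[OF \<phi>])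
      have "D_x i (D_x i (distr (\<lambda>z. q (fst z) * (norm (snd z))\<^sup>2))) \<phi> = D_x i (distr (\<lambda>z. (2 * q (fst z)) * snd z $ i)) \<phi>"
        by (simp only: P[OF t] distr_deriv_def[of _ "distr_deriv _ _"] distr_deriv_def[of _ "distr (\<lambda>z. (2 * q (fst z)) * snd z $ i)"])
      also have "\<dots> = distr (\<lambda>z. 2 * q (fst z)) \<phi>"
        using D_x_separated[OF \<phi> q2 has_derivative_component, of i i] by simp
      finally show ?thesis .
    qed
    then have "(\<Sum>i\<in>UNIV. D_x i (D_x i (distr (\<lambda>z. q (fst z) * (norm (snd z))\<^sup>2))) \<phi>) = distr (\<lambda>z. CARD('n) * (2 * q (fst z))) \<phi>"
      by (simp only: distr_cmult) simp
    also have "\<dots> = distr (\<lambda>z. R (fst z)) \<phi>"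
      by (rule distr_cong[OF \<phi>]) (auto simp: spacetime_def poisson)
    finally show ?thesis .
  qed
  show ?thesis
    unfolding EP_distributional_def
  proof (intro conjI allI impI exI[of _ G])
    show "loc_integrable (\<lambda>z :: real \<times> (real ^ 'n). q (fst z) * (norm (snd z))\<^sup>2)"
      by (intro loc_integrable_continuous sep[OF cq c_norm2])
    show "loc_integrable (\<lambda>z :: real \<times> (real ^ 'n). (h (fst z) *\<^sub>R snd z) $ i)" for i
      unfolding vector_scaleR_component real_scaleR_def by (rule loc_integrable_continuous[OF cv])
    show "loc_integrable (\<lambda>z :: real \<times> (real ^ 'n). R (fst z) * (h (fst z) *\<^sub>R snd z) $ i)" for i
      unfolding vector_scaleR_component real_scaleR_def
      by (rule loc_integrable_continuous[OF continuous_on_mult[OF cR0 cv]])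
    show "loc_integrable (\<lambda>z :: real \<times> (real ^ 'n). (h (fst z) *\<^sub>R snd z) $ j * G i j z)" for i j
      unfolding vector_scaleR_component real_scaleR_def
      by (rule loc_integrable_continuous[OF continuous_on_mult[OF cv cG]])
  qed (fact cont_eq G mom_eq poisson_eq | intro loc_integrable_continuous cG cR0)+
qed

section \<open>Linear velocity fields\<close>

text \<open>Reduction of the system to functions of time: v = h r and \<Phi> = Q r^2 / 2, so
  \<Phi>_r = Q r, and \<open>R t = n * Q t\<close> because the radial Laplacian of r^2 / 2 is n. In
  the application h is the logarithmic derivative of s.\<close>

locale linear_flow =
  fixes n :: nat and lam :: real and R h h' Q :: "real \<Rightarrow> real"
  assumes n: "n \<ge> 1"
    and R: "\<And>t. t \<ge> 0 \<Longrightarrow> (R has_real_derivative - (n * (R t * h t))) (at t within {0..})"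
    and h: "\<And>t. t \<ge> 0 \<Longrightarrow> (h has_real_derivative h' t) (at t within {0..})"
    and mom: "\<And>t. t \<ge> 0 \<Longrightarrow> h' t + (h t)\<^sup>2 = - lam * Q t"
    and poisson: "\<And>t. t \<ge> 0 \<Longrightarrow> R t = n * Q t"
    and h0: "h 0 = 0"
begin

lemma power_n: "(r::real) ^ n = r * r ^ (n - 1)"
  using n by (cases n) auto

lemma radial_EP: "radial_EP n lam (\<lambda>_. R 0) (\<lambda>_. 0) (\<lambda>t r. R t) (\<lambda>t r. h t * r) (\<lambda>t r. Q t * (r\<^sup>2 / 2))"
proof -
  have mass: "mass n (\<lambda>t r. R t) t r = R t * (r ^ n / n)" if "r \<ge> 0" for t r
    unfolding mass_def
    using has_integral_mult_right[OF has_integral_power_pred[OF n that], of "R t"] by (rule integral_unique)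
  have "radial_mass_transport n (\<lambda>t r. R t) (\<lambda>t r. h t * r)"
    unfolding radial_mass_transport_def
  proof (intro allI impI exI conjI)
    fix t r :: real assume t: "0 \<le> t" and r: "0 < r"
    show "((\<lambda>\<tau>. mass n (\<lambda>t r. R t) \<tau> r) has_real_derivative - (n * (R t * h t)) * (r ^ n / n)) (at t within {0..})"
      using r by (simp only: mass[of r] less_imp_le) (rule DERIV_cmult_right[OF R[OF t]])
    have "((\<lambda>r. R t * (r ^ n / n)) has_real_derivative R t * r ^ (n - 1)) (at r)"
      using n by (auto intro!: derivative_eq_intros)
    then show "(mass n (\<lambda>t r. R t) t has_real_derivative R t * r ^ (n - 1)) (at r)"
      by (rule has_field_derivative_transform_within_open[where S = "{0<..}"]) (use r mass in auto)
    show "- (n * (R t * h t)) * (r ^ n / n) + h t * r * (R t * r ^ (n - 1)) = 0"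
      using n by (simp add: power_n)
  qed
  moreover have "radial_momentum lam (\<lambda>t r. h t * r) (\<lambda>t r. Q t * (r\<^sup>2 / 2))"
    unfolding radial_momentum_def
  proof (intro allI impI exI conjI)
    fix t r :: real assume t: "0 \<le> t" and r: "0 < r"
    show "((\<lambda>\<tau>. h \<tau> * r) has_real_derivative h' t * r) (at t within {0..})"
      by (rule DERIV_cmult_right[OF h[OF t]])
    show "((\<lambda>r. h t * r) has_real_derivative h t) (at r)"
      "((\<lambda>r. Q t * (r\<^sup>2 / 2)) has_real_derivative Q t * r) (at r)"
      by (auto intro!: derivative_eq_intros)
    have "h' t * r + h t * r * h t + lam * (Q t * r) = (h' t + (h t)\<^sup>2 + lam * Q t) * r"
      by (simp add: algebra_simps power2_eq_square)
    then show "h' t * r + h t * r * h t + lam * (Q t * r) = 0" using mom[OF t] by simp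
  qed
  moreover have "radial_poisson n (\<lambda>t r. R t) (\<lambda>t r. Q t * (r\<^sup>2 / 2))"
    unfolding radial_poisson_def
  proof (intro allI impI)
    fix t :: real assume t: "0 \<le> t"
    have "((\<lambda>r. Q t * (r\<^sup>2 / 2)) has_real_derivative Q t * r) (at r)" for r
      by (auto intro!: derivative_eq_intros)
    moreover have "((\<lambda>r. r ^ (n - 1) * (Q t * r)) has_real_derivative r ^ (n - 1) * R t) (at r)" for r
    proof -
      have "(\<lambda>r. r ^ (n - 1) * (Q t * r)) = (\<lambda>r. Q t * r ^ n)" by (simp add: power_n fun_eq_iff)
      moreover have "((\<lambda>r. Q t * r ^ n) has_real_derivative r ^ (n - 1) * R t) (at r)"
        using n by (auto intro!: derivative_eq_intros simp: poisson[OF t])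
      ultimately show ?thesis by simp
    qed
    ultimately show "\<exists>\<Phi>r. \<forall>r>0. ((\<lambda>r. Q t * (r\<^sup>2 / 2)) has_real_derivative \<Phi>r r) (at r) \<and>
       ((\<lambda>s. s ^ (n - 1) * \<Phi>r s) has_real_derivative r ^ (n - 1) * R t) (at r)"
      by (intro exI[of _ "\<lambda>r. Q t * r"]) blast
  qed
  ultimately show ?thesis unfolding radial_EP_def by (simp add: h0)
qed

lemma radial_continuity: "radial_continuity n (\<lambda>t r. R t) (\<lambda>t r. h t * r)"
  unfolding radial_continuity_def
proof (intro allI impI exI conjI)
  fix t r :: real assume t: "0 \<le> t" and r: "0 < r"
  show "(R has_real_derivative - (n * (R t * h t))) (at t within {0..})" by (rule R[OF t])
  have "(\<lambda>s. s ^ (n - 1) * R t * (h t * s)) = (\<lambda>s. R t * h t * s ^ n)" by (simp add: power_n fun_eq_iff)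
  moreover have "((\<lambda>s. R t * h t * s ^ n) has_real_derivative r ^ (n - 1) * (n * (R t * h t))) (at r)"
    using n by (auto intro!: derivative_eq_intros)
  ultimately show "((\<lambda>s. s ^ (n - 1) * R t * (h t * s)) has_real_derivative r ^ (n - 1) * (n * (R t * h t))) (at r)"
    by simp
  show "r ^ (n - 1) * - (n * (R t * h t)) + r ^ (n - 1) * (n * (R t * h t)) = 0" by simp
qed

end

section \<open>Assembly of the explicit solution and the final statement\<close>

lemma radial_scalar_const: "radial_scalar (\<lambda>t r. R t) = (\<lambda>z. R (fst z))"
  by (simp add: radial_scalar_def fun_eq_iff)

lemma radial_vector_linear: "radial_vector (\<lambda>t r. h t * r) = (\<lambda>z. h (fst z) *\<^sub>R snd z)"
  by (auto simp: radial_vector_def fun_eq_iff)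

lemma radial_scalar_square: "radial_scalar (\<lambda>t r. Q t * (r\<^sup>2 / 2)) = (\<lambda>z. (Q (fst z) / 2) * (norm (snd z))\<^sup>2)"
  by (simp add: radial_scalar_def fun_eq_iff)

lemma C_curves_antimono: "k \<le> l \<Longrightarrow> C_curves l I s \<subseteq> C_curves k I s"
  unfolding C_curves_def by (auto intro: order_trans)

text \<open>The case lam = 0 is set apart because the static state is then a global solution and the
  equivalence would fail. The type variable carries the dimension of the space in which the
  distributional equations are stated.\<close>

theorem corollary1p20:
  fixes n :: nat and lam \<rho>c :: real
  assumes "n \<ge> 1" and dim: "n = CARD('n::finite)"
    and "lam \<noteq> 0"
    and "\<rho>c > 0"
  shows "(has_global_solution n lam (\<lambda>r. \<rho>c) (\<lambda>r. 0) \<longleftrightarrow> lam < 0) \<and>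
    (lam < 0 \<longrightarrow> (\<exists>\<rho> v \<Phi>.
       radial_EP n lam (\<lambda>r. \<rho>c) (\<lambda>r. 0) \<rho> v \<Phi> \<and>
       radial_continuity n \<rho> v \<and>
       (\<forall>t\<ge>0. \<Phi> t 0 = 0) \<and>
       \<rho> \<in> C_curves 2 {0..} \<infinity> \<inter> C_curves \<infinity> {0<..} \<infinity> \<and>
       v \<in> C_curves 1 {0..} \<infinity> \<inter> C_curves \<infinity> {0<..} \<infinity> \<and>
       \<Phi> \<in> C_curves 2 {0..} \<infinity> \<inter> C_curves \<infinity> {0<..} \<infinity> \<and>
       (\<forall>\<rho>' v' \<Phi>'.
          \<rho>' \<in> C_curves 2 {0..} 0 \<and> v' \<in> C_curves 1 {0..} 1 \<and> \<Phi>' \<in> C_curves 2 {0..} 2 \<and>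
          radial_EP n lam (\<lambda>r. \<rho>c) (\<lambda>r. 0) \<rho>' v' \<Phi>' \<longrightarrow>
          (\<forall>t\<ge>0. \<forall>r\<ge>0. \<rho>' t r = \<rho> t r \<and> v' t r = v t r) \<and>
          ((\<forall>t\<ge>0. \<Phi>' t 0 = 0) \<longrightarrow> (\<forall>t\<ge>0. \<forall>r\<ge>0. \<Phi>' t r = \<Phi> t r))) \<and>
       EP_distributional lam (radial_scalar \<rho> :: real \<times> (real ^ 'n) \<Rightarrow> real)
         (radial_vector v) (radial_scalar \<Phi>)))"
proof (cases "lam < 0")
  case False
  then show ?thesis using no_global_solution[OF assms(1) _ assms(4), of lam] assms(3) by auto
next
  case True
  note n = assms(1) and \<rho>c = assms(4)
  define a where "a = - (lam * \<rho>c / n)"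
  have a: "a > 0" using True n \<rho>c by (simp add: a_def divide_neg_pos mult_neg_pos)
  obtain s p where sp: "s 0 = 1" "p 0 = 0"
    "\<And>t. 0 \<le> t \<Longrightarrow> (s has_real_derivative p t) (at t within {0..})"
    "\<And>t. 0 \<le> t \<Longrightarrow> (p has_real_derivative a * inverse (s t) ^ (n - 1)) (at t within {0..})"
    "\<And>t. 0 \<le> t \<Longrightarrow> s t \<ge> 1"
    using expanding_ode_exists[OF a, of "n - 1"] by blast
  have s_pos: "s t > 0" if "t \<ge> 0" for t using sp(5)[OF that] by simp
  define \<sigma> where "\<sigma> = (\<lambda>t. inverse (s t))"
  define R where "R = (\<lambda>t. \<rho>c * \<sigma> t ^ n)"
  define h where "h = (\<lambda>t. p t * \<sigma> t)"
  \<comment> \<open>The equation of s gives p' \<sigma> = a \<sigma>^n, and p \<sigma>' = - h^2. The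
    spelling keeps the expression visibly within the algebra generated by \<sigma> and p.\<close>
  define h' where "h' = (\<lambda>t. a * \<sigma> t ^ n + - 1 * (h t * h t))"
  define Q where "Q = (\<lambda>t. (\<rho>c / n) * \<sigma> t ^ n)"
  have \<sigma>: "(\<sigma> has_real_derivative - 1 * (p t * (\<sigma> t * \<sigma> t))) (at t within {0..})" if "t \<ge> 0" for t
    unfolding \<sigma>_def using s_pos[OF that] sp(3)[OF that]
    by (auto intro!: derivative_eq_intros simp: power2_eq_square)
  have \<sigma>_power: "\<sigma> t ^ n = \<sigma> t * \<sigma> t ^ (n - 1)" for t using n by (cases n) auto
  have dR: "(R has_real_derivative - (n * (R t * h t))) (at t within {0..})" if "t \<ge> 0" for t
  proof -
    have "(R has_real_derivative \<rho>c * (n * ((- 1 * (p t * (\<sigma> t * \<sigma> t))) * \<sigma> t ^ (n - Suc 0)))) (at t within {0..})"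
      unfolding R_def by (intro DERIV_cmult DERIV_power \<sigma> that)
    then show ?thesis by (simp add: R_def h_def \<sigma>_power mult_ac)
  qed
  have dh: "(h has_real_derivative h' t) (at t within {0..})" if "t \<ge> 0" for t
    unfolding h_def h'_def
    by (rule DERIV_cong[OF DERIV_mult[OF sp(4)[OF that] \<sigma>[OF that]]])
      (simp add: \<sigma>_power, simp add: \<sigma>_def)
  interpret linear_flow n lam R h h' Q
  proof
    show "h' t + (h t)\<^sup>2 = - lam * Q t" for t
      by (simp add: h'_def Q_def a_def power2_eq_square)
    show "R t = n * Q t" for t using n by (simp add: R_def Q_def)
    show "h 0 = 0" by (simp add: h_def sp)
  qed (use n dR dh in auto)
  have R0: "R 0 = \<rho>c" by (simp add: R_def \<sigma>_def sp)
  define A where "A = poly_closure {\<sigma>, p}"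
  have A: "\<sigma> \<in> A" "p \<in> A" unfolding A_def by (auto intro: poly_closure.base)
  have A_add: "f \<in> A \<Longrightarrow> g \<in> A \<Longrightarrow> (\<lambda>t. f t + g t) \<in> A" for f g
    unfolding A_def by (rule poly_closure.add)
  have A_mult: "f \<in> A \<Longrightarrow> g \<in> A \<Longrightarrow> (\<lambda>t. f t * g t) \<in> A" for f g
    unfolding A_def by (rule poly_closure.mult)
  have A_cmult: "f \<in> A \<Longrightarrow> (\<lambda>t. c * f t) \<in> A" for f c
    unfolding A_def by (intro poly_closure.mult poly_closure.const)
  have A_pow: "f \<in> A \<Longrightarrow> (\<lambda>t. f t ^ k) \<in> A" for f k
    unfolding A_def by (rule poly_closure_power)
  \<comment> \<open>Generators differentiate into the algebra: \<sigma>' = - p \<sigma>^2 and p' = a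
    \<sigma>^(n-1).\<close>
  have closed: "\<exists>g'\<in>A. \<forall>t\<in>{0..}. (g has_real_derivative g' t) (at t within {0..})" if "g \<in> A" for g
    unfolding A_def
  proof (rule poly_closure_deriv)
    fix b assume b: "b \<in> {\<sigma>, p}"
    have "(\<lambda>t. - 1 * (p t * (\<sigma> t * \<sigma> t))) \<in> A" "(\<lambda>t. a * \<sigma> t ^ (n - 1)) \<in> A"
      by (intro A_cmult A_mult A_pow A)+
    then show "\<exists>b'\<in>poly_closure {\<sigma>, p}. \<forall>t\<in>{0..}. (b has_real_derivative b' t) (at t within {0..})"
      using b \<sigma> sp(4) unfolding A_def \<sigma>_def by fastforce
  qed (use that in \<open>simp add: A_def\<close>)
  have closed': "\<exists>g'\<in>A. \<forall>t\<in>{0<..}. (g has_real_derivative g' t) (at t within {0<..})" if g: "g \<in> A" for g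
  proof -
    obtain g' where "g' \<in> A" "\<forall>t\<in>{0..}. (g has_real_derivative g' t) (at t within {0..})"
      using closed[OF g] by blast
    then show ?thesis
      by (intro bexI[of _ g'] ballI has_field_derivative_subset[of g _ _ "{0..}" "{0<..}"]) auto
  qed
  have RhQ: "R \<in> A" "h \<in> A" "Q \<in> A"
    unfolding R_def h_def Q_def by (intro A_cmult A_mult A_pow A)+
  define \<rho> where "\<rho> = (\<lambda>t (r::real). R t)"
  define v where "v = (\<lambda>t r. h t * r)"
  define \<Phi> where "\<Phi> = (\<lambda>t r. Q t * (r\<^sup>2 / 2))"
  have \<rho>_curves: "\<rho> \<in> C_curves k {0..} d" "\<rho> \<in> C_curves k {0<..} d" for k d
    using C_curves_monomial[OF closed RhQ(1), of 0] C_curves_monomial[OF closed' RhQ(1), of 0] by (auto simp: \<rho>_def)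
  have v_curves: "v \<in> C_curves k {0..} d" "v \<in> C_curves k {0<..} d" for k d
    using C_curves_monomial[OF closed RhQ(2), of 1] C_curves_monomial[OF closed' RhQ(2), of 1] by (auto simp: v_def)
  have \<Phi>_curves: "\<Phi> \<in> C_curves k {0..} d" "\<Phi> \<in> C_curves k {0<..} d" for k d
    using C_curves_monomial[OF closed RhQ(3), of 2] C_curves_monomial[OF closed' RhQ(3), of 2] by (auto simp: \<Phi>_def)
  have EP: "radial_EP n lam (\<lambda>r. \<rho>c) (\<lambda>r. 0) \<rho> v \<Phi>"
    using radial_EP by (simp only: R0 \<rho>_def v_def \<Phi>_def)
  have unique: "(\<forall>t\<ge>0. \<forall>r\<ge>0. \<rho>' t r = \<rho> t r \<and> v' t r = v t r) \<and>
          ((\<forall>t\<ge>0. \<Phi>' t 0 = 0) \<longrightarrow> (\<forall>t\<ge>0. \<forall>r\<ge>0. \<Phi>' t r = \<Phi> t r))"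
    if sol: "\<rho>' \<in> C_curves 2 {0..} 0" "v' \<in> C_curves 1 {0..} 1" "\<Phi>' \<in> C_curves 2 {0..} 2"
      "radial_EP n lam (\<lambda>r. \<rho>c) (\<lambda>r. 0) \<rho>' v' \<Phi>'" for \<rho>' v' \<Phi>'
  proof -
    have "(1::enat) \<le> 2" by simp
    then have "\<rho>' \<in> C_curves 1 {0..} 0" using sol(1) C_curves_antimono by blast
    then interpret static_start n lam \<rho>c \<rho>' v' \<Phi>'
      by unfold_locales (use assms sol in auto)
    have eq: "r \<ge> 0 \<Longrightarrow> \<rho>' t r = \<rho>c / s t ^ n" "r \<ge> 0 \<Longrightarrow> v' t r = r * p t / s t"
      "r > 0 \<Longrightarrow> (\<Phi>' t has_real_derivative \<rho>c * r / (n * s t ^ n)) (at r)" if t: "t \<ge> 0" for t r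
    proof -
      have ds: "(s has_real_derivative p x) (at x within {0..t})" if "x \<in> {0..t}" for x
        by (rule has_field_derivative_subset[OF sp(3)]) (use that in auto)
      have "(p has_real_derivative a * inverse (s x) ^ (n - 1)) (at x within {0..t})" if "x \<in> {0..t}" for x
        by (rule has_field_derivative_subset[OF sp(4)]) (use that in auto)
      note dp = this[unfolded a_def]
      have s0: "s x > 0" if "x \<in> {0..t}" for x using s_pos that by simp
      have tt: "t \<in> {0..t}" using t by simp
      show "r \<ge> 0 \<Longrightarrow> \<rho>' t r = \<rho>c / s t ^ n"
        by (rule solution_formula(1)[OF ds dp s0 sp(1,2) tt])
      show "r \<ge> 0 \<Longrightarrow> v' t r = r * p t / s t"
        by (rule solution_formula(2)[OF ds dp s0 sp(1,2) tt])
      show "r > 0 \<Longrightarrow> (\<Phi>' t has_real_derivative \<rho>c * r / (n * s t ^ n)) (at r)"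
        by (rule solution_formula(3)[OF ds dp s0 sp(1,2) tt])
    qed
    \<comment> \<open>The equations determine only the r-derivative of \<Phi>', so the free additive
      constant may depend on t; this is why the normalisation at r = 0 is imposed at every
      time.\<close>
    have "\<Phi>' t r = \<Phi> t r" if ini: "\<forall>t\<ge>0. \<Phi>' t 0 = 0" and t: "t \<ge> 0" and r: "r \<ge> 0" for t r
    proof (cases "r = 0")
      case True
      then show ?thesis using ini t by (simp add: \<Phi>_def)
    next
      case False
      have "C_curve 0 2 {0..} \<Phi>'" using sol(3) unfolding C_curves_def mem_Collect_eq
        by (metis zero_enat_def zero_le)
      then have "continuous_on {0..} (\<Phi>' t)" using t by (simp add: D_space_def)
      then have "continuous_on {0..r} (\<Phi>' t)" by (rule continuous_on_subset) auto
      then have "continuous_on {0..r} (\<lambda>r. \<Phi>' t r - \<Phi> t r)"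
        unfolding \<Phi>_def by (intro continuous_intros) auto
      moreover have "((\<lambda>r. \<Phi>' t r - \<Phi> t r) has_real_derivative 0) (at x)" if "0 < x" for x
      proof -
        have "(\<Phi> t has_real_derivative \<rho>c * x / (n * s t ^ n)) (at x)"
        proof -
          have "(\<Phi> t has_real_derivative Q t * x) (at x)"
            unfolding \<Phi>_def by (auto intro!: derivative_eq_intros)
          moreover have "Q t * x = \<rho>c * x / (n * s t ^ n)"
            by (simp add: Q_def \<sigma>_def field_simps)
          ultimately show ?thesis by simp
        qed
        from DERIV_diff[OF eq(3)[OF t that] this] show ?thesis by simp
      qed
      ultimately have "\<Phi>' t r - \<Phi> t r = \<Phi>' t 0 - \<Phi> t 0"
        using r False by (intro DERIV_isconst_end[where f = "\<lambda>r. \<Phi>' t r - \<Phi> t r"]) auto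
      then show ?thesis using ini t by (simp add: \<Phi>_def)
    qed
    moreover have "\<rho> t r = \<rho>c / s t ^ n" "v t r = r * p t / s t" for t r
      by (simp_all add: \<rho>_def v_def R_def h_def \<sigma>_def field_simps)
    ultimately show ?thesis
      using eq(1,2) by simp
  qed
  have "EP_distributional lam (\<lambda>z :: real \<times> (real ^ 'n). R (fst z))
    (\<lambda>z. h (fst z) *\<^sub>R snd z) (\<lambda>z. (Q (fst z) / 2) * (norm (snd z))\<^sup>2)"
  proof -
    have at_eq: "at t within {0..} = at t" if "t > 0" for t :: real
      using that by (intro at_within_interior) simp
    obtain Q' where Q': "\<And>t. t \<ge> 0 \<Longrightarrow> (Q has_real_derivative Q' t) (at t within {0..})"
      using closed[OF RhQ(3)] by auto
    \<comment> \<open>Membership makes h' differentiable, hence continuous, as the distributional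
      time derivative of v requires.\<close>
    have "h' \<in> A"
      unfolding h'_def by (intro A_add A_cmult A_mult A_pow A RhQ)
    then obtain h'' where h'': "\<And>t. t \<ge> 0 \<Longrightarrow> (h' has_real_derivative h'' t) (at t within {0..})"
      using closed by force
    have "continuous_on {0..} h'" by (rule DERIV_continuous_on) (use h'' in auto)
    then have c: "continuous_on {0<..} h'" by (rule continuous_on_subset) auto
    show ?thesis
    proof (rule EP_distributional_linear_flow[where q = "\<lambda>t. Q t / 2" and q' = "\<lambda>t. Q' t / 2", OF _ _ _ c])
      fix t :: real assume t: "t > 0"
      show "(R has_real_derivative - (CARD('n) * (R t * h t))) (at t)"
        using dR[of t] t unfolding dim by (simp add: at_eq)
      show "(h has_real_derivative h' t) (at t)" using dh[of t] t by (simp add: at_eq)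
      show "((\<lambda>t. Q t / 2) has_real_derivative Q' t / 2) (at t)"
        using Q'[of t] t by (intro DERIV_cdivide) (simp add: at_eq)
      show "h' t + (h t)\<^sup>2 = - lam * (2 * (Q t / 2))" using mom[of t] t by simp
      show "R t = CARD('n) * (2 * (Q t / 2))" using poisson[of t] t by (simp add: dim)
    qed
  qed
  then have distr: "EP_distributional lam (radial_scalar \<rho> :: real \<times> (real ^ 'n) \<Rightarrow> real) (radial_vector v) (radial_scalar \<Phi>)"
    unfolding \<rho>_def v_def \<Phi>_def radial_scalar_const radial_vector_linear radial_scalar_square .
  have "has_global_solution n lam (\<lambda>r. \<rho>c) (\<lambda>r. 0)"
    unfolding has_global_solution_def using EP \<rho>_curves(1) v_curves(1) \<Phi>_curves(1) by blast
  with True have global: "has_global_solution n lam (\<lambda>r. \<rho>c) (\<lambda>r. 0) \<longleftrightarrow> lam < 0" by simp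
  have "radial_continuity n \<rho> v"
    unfolding \<rho>_def v_def by (rule radial_continuity)
  moreover have "\<forall>t\<ge>0. \<Phi> t 0 = 0" by (simp add: \<Phi>_def)
  moreover note IntI[OF \<rho>_curves] IntI[OF v_curves] IntI[OF \<Phi>_curves]
  moreover have "\<forall>\<rho>' v' \<Phi>'.
          \<rho>' \<in> C_curves 2 {0..} 0 \<and> v' \<in> C_curves 1 {0..} 1 \<and> \<Phi>' \<in> C_curves 2 {0..} 2 \<and>
          radial_EP n lam (\<lambda>r. \<rho>c) (\<lambda>r. 0) \<rho>' v' \<Phi>' \<longrightarrow>
          (\<forall>t\<ge>0. \<forall>r\<ge>0. \<rho>' t r = \<rho> t r \<and> v' t r = v t r) \<and>
          ((\<forall>t\<ge>0. \<Phi>' t 0 = 0) \<longrightarrow> (\<forall>t\<ge>0. \<forall>r\<ge>0. \<Phi>' t r = \<Phi> t r))"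
    by (intro allI impI unique) (elim conjE, assumption)+
  ultimately show ?thesis
    using global EP distr by (intro conjI impI exI[of _ \<rho>] exI[of _ v] exI[of _ \<Phi>]) assumption+
qed

end
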